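(* Let $A\in\mathbb{C}^{n\times n}$ be skew-Hermitian, let $B\in\mathbb{C}^{n\times m}$, and let $\gamma_{\mathrm{decay}}(A,B)$ be the decay rate of the closed-loop system of the associated linear quadratic regulator problem (see context). Then the following upper bound always holds: $$\gamma_{\mathrm{decay}}(A,B)\le\|B\|.$$ If in addition the smallest singular value $\sigma_m$ of $B$ satisfies $\sigma_m>2\sqrt2\,\Delta$ and $m<n$, then $$\gamma_{\mathrm{decay}}(A,B)<\sqrt3\,\Delta.$$ If $m=1$, then $\gamma_{\mathrm{decay}}(A,B)\le 2\sqrt2\,\Delta$ for any $B$ such that the pair $(A,B)$ is controllable.
   Context: Standing setting: $m\le n$; $A\in\mathbb{C}^{n\times n}$ is skew-Hermitian ($A^*=-A$); $B\in\mathbb{C}^{n\times m}$ with $\ker B=\{0\}$; the pair $(A,B)$ is stabilizable, so that the linear quadratic regulator problem below is solvable. $\|\cdot\|$ is the Euclidean norm of vectors and the induced norm of matrices. The eigenvalues of $A$ are $i\lambda_1,\dots,i\lambda_n$ with $\lambda_1\le\dots\le\lambda_n$ real, and $\Delta=\max_{j,k}|\lambda_j-\lambda_k|=\lambda_n-\lambda_1$. Linear quadratic regulator: for $x'(t)=Ax(t)+Bu(t)$, $x(0)=x_0$, minimize $J^u(x_0)=\int_0^\infty \big(x(t)^*x(t)+u(t)^*u(t)\big)\,dt$. The optimal control is $u(t)=-Fx(t)$ with $F=B^*X$, where $X$ is the unique nonnegative (in fact positive definite) solution of $XBB^*X-XA-A^*X-I=0$. The closed-loop matrix is $A_{\mathrm{cl.loop}}=A-BF=A-BB^*X$;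 it is stable, i.e. its spectrum lies in the open left half-plane. Put $\gamma_{\mathrm{decay}}(A,B)=\min\{|\operatorname{Re}\nu|:\nu\text{ an eigenvalue of }A_{\mathrm{cl.loop}}\}$.
   Formalization: The third claim (m=1) is stated under the additional condition m<n, i.e. n≥2; for n=m=1 it is false: A=[ia], B=[b] with b≠0 is controllable, Δ=0, but the decay rate is |b|>0. *)

theory Defs
  imports "HOL-Analysis.Analysis"
begin

text \<open>
  An \<open>n \<times> m\<close> complex matrix is a value of type \<^typ>\<open>complex ^ 'm ^ 'n\<close> with \<open>n\<close> = \<open>CARD('n)\<close> and
  \<open>m\<close> = \<open>CARD('m)\<close>.  The library norm on \<^typ>\<open>complex ^ 'n\<close> is the Euclidean norm.
\<close>

definition conj_transpose :: "complex ^ 'm ^ 'n \<Rightarrow> complex ^ 'n ^ 'm" where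
  "conj_transpose M = map_matrix cnj (transpose M)"

definition skew_Hermitian :: "complex ^ 'n ^ 'n \<Rightarrow> bool" where
  "skew_Hermitian M \<longleftrightarrow> conj_transpose M = - M"

text \<open>
  The library inner product on \<^typ>\<open>complex ^ 'n\<close> is real-valued: \<^term>\<open>v \<bullet> w\<close> is the real part of
  \<open>v\<^sup>* w\<close>.  For a Hermitian matrix \<open>M\<close> the number \<open>v\<^sup>* M v\<close> is real, hence equal to
  \<^term>\<open>v \<bullet> (M *v v)\<close>.
\<close>

definition nonneg_Hermitian :: "complex ^ 'n ^ 'n \<Rightarrow> bool" where
  "nonneg_Hermitian M \<longleftrightarrow> conj_transpose M = M \<and> (\<forall>v. 0 \<le> v \<bullet> (M *v v))"

definition matrix_norm :: "complex ^ 'm ^ 'n \<Rightarrow> real" where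
  "matrix_norm M = onorm (\<lambda>v. M *v v)"

definition eigenvalues :: "complex ^ 'n ^ 'n \<Rightarrow> complex set" where
  "eigenvalues M = {\<nu>. \<exists>v. v \<noteq> 0 \<and> M *v v = \<nu> *s v}"

text \<open>For \<open>m \<le> n\<close>, the singular values of an \<open>n \<times> m\<close> matrix are the square roots of the \<open>m\<close>
  eigenvalues of \<open>M\<^sup>* M\<close>.\<close>

definition singular_values :: "complex ^ 'm ^ 'n \<Rightarrow> real set" where
  "singular_values M = {s. 0 \<le> s \<and> complex_of_real (s\<^sup>2) \<in> eigenvalues (conj_transpose M ** M)}"

definition smallest_singular_value :: "complex ^ 'm ^ 'n \<Rightarrow> real" where
  "smallest_singular_value M = Min (singular_values M)"

text \<open>For skew-Hermitian \<open>A\<close> with eigenvalues \<open>i \<lambda>\<^sub>j\<close>, this is the maximum of \<open>\<bar>\<lambda>\<^sub>j - \<lambda>\<^sub>k\<bar>\<close>.\<close>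

definition spectral_spread :: "complex ^ 'n ^ 'n \<Rightarrow> real" where
  "spectral_spread A = Max {\<bar>l - k\<bar> | l k. \<i> * complex_of_real l \<in> eigenvalues A
                                         \<and> \<i> * complex_of_real k \<in> eigenvalues A}"

definition stable_matrix :: "complex ^ 'n ^ 'n \<Rightarrow> bool" where
  "stable_matrix M \<longleftrightarrow> (\<forall>\<nu> \<in> eigenvalues M. Re \<nu> < 0)"

definition stabilizable :: "complex ^ 'n ^ 'n \<Rightarrow> complex ^ 'm ^ 'n \<Rightarrow> bool" where
  "stabilizable A B \<longleftrightarrow> (\<exists>F :: complex ^ 'n ^ 'm. stable_matrix (A - B ** F))"

text \<open>Every state can be steered to every state in finite time along \<open>x' = A x + B u\<close>.\<close>

definition controllable :: "complex ^ 'n ^ 'n \<Rightarrow> complex ^ 'm ^ 'n \<Rightarrow> bool" where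
  "controllable A B \<longleftrightarrow>
     (\<forall>x0 x1. \<exists>T > 0. \<exists>(u :: real \<Rightarrow> complex ^ 'm) (x :: real \<Rightarrow> complex ^ 'n).
        continuous_on {0..T} u \<and> x 0 = x0 \<and> x T = x1 \<and>
        (\<forall>t \<in> {0..T}. (x has_vector_derivative (A *v x t + B *v u t)) (at t within {0..T})))"

definition riccati_equation ::
    "complex ^ 'n ^ 'n \<Rightarrow> complex ^ 'm ^ 'n \<Rightarrow> complex ^ 'n ^ 'n \<Rightarrow> bool" where
  "riccati_equation A B X \<longleftrightarrow>
     X ** B ** conj_transpose B ** X - X ** A - conj_transpose A ** X - mat 1 = 0"

text \<open>For stabilizable \<open>(A, B)\<close> the Riccati equation has exactly one nonnegative solution.\<close>

definition riccati_solution ::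
    "complex ^ 'n ^ 'n \<Rightarrow> complex ^ 'm ^ 'n \<Rightarrow> complex ^ 'n ^ 'n" where
  "riccati_solution A B = (THE X. nonneg_Hermitian X \<and> riccati_equation A B X)"

text \<open>The linear quadratic regulator for \<open>x' = A x + B u\<close> with cost \<open>\<integral> x\<^sup>* x + u\<^sup>* u\<close> over
  \<open>[0, \<infinity>)\<close> has the optimal control \<open>u = - F x\<close> with the gain \<open>F\<close> below.\<close>

definition feedback_gain :: "complex ^ 'n ^ 'n \<Rightarrow> complex ^ 'm ^ 'n \<Rightarrow> complex ^ 'n ^ 'm" where
  "feedback_gain A B = conj_transpose B ** riccati_solution A B"

definition closed_loop :: "complex ^ 'n ^ 'n \<Rightarrow> complex ^ 'm ^ 'n \<Rightarrow> complex ^ 'n ^ 'n" where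
  "closed_loop A B = A - B ** feedback_gain A B"

definition decay_rate :: "complex ^ 'n ^ 'n \<Rightarrow> complex ^ 'm ^ 'n \<Rightarrow> real" where
  "decay_rate A B = Min ((\<lambda>\<nu>. \<bar>Re \<nu>\<bar>) ` eigenvalues (closed_loop A B))"

end

(*
  Put P = B B^*, let X be the nonnegative Riccati solution and K = A - P X the closed loop.  If v is
  an eigenvector of K for nu and y = X v, then (A - nu) y = v and (A - nu) v = P y.  As A is
  skew-Hermitian, A - nu is bounded below by |Re nu|, hence |Re nu|^2 |y| <= |P y| <= |B|^2 |y|.

  For the second bound let D be the spectral spread and Q the orthogonal projection onto ker B^*.
  If sigma_m > 2 sqrt 2 D, the form of W = D X - Q - sqrt 3 D^2 X Q X strictly decreases along the flow
  of K + sqrt 3 D: A couples range B and ker B^* with norm at most D / 2, since A is within D / 2 of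
  a scalar.  If K + sqrt 3 D had no eigenvalue with positive real part, W would be positive definite
  by Lyapunov's theorem; but it is nonpositive on the kernel of B^* X, which is nontrivial for m < n.

  For m = 1 the only singular value of B is |B|, so one of the first two bounds applies.

  Lyapunov's theorem and the uniqueness for Sylvester equations are derived from the existence of
  eigenvectors modulo invariant subspaces, and the Riccati equation is solved by Kleinman's iteration.
*)
theory Submission
  imports Defs "HOL-Computational_Algebra.Fundamental_Theorem_Algebra"
begin

subsection \<open>Complex matrices and the real inner product\<close>

lemma inner_complex_vec:
  fixes x y :: "complex ^ 'n"
  shows "x \<bullet> y = Re (\<Sum>i\<in>UNIV. cnj (x $ i) * y $ i)"
  by (simp add: inner_vec_def inner_complex_def Re_sum)

lemma inner_matrix_left:
  fixes M :: "complex ^ 'm ^ 'n"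
  shows "(M *v x) \<bullet> y = x \<bullet> (conj_transpose M *v y)"
proof -
  have "(\<Sum>i\<in>UNIV. cnj ((M *v x) $ i) * y $ i)
      = (\<Sum>i\<in>UNIV. \<Sum>j\<in>UNIV. cnj (M $ i $ j) * cnj (x $ j) * y $ i)"
    by (simp add: matrix_vector_mult_def sum_distrib_right)
  also have "\<dots> = (\<Sum>j\<in>UNIV. \<Sum>i\<in>UNIV. cnj (M $ i $ j) * cnj (x $ j) * y $ i)"
    by (rule sum.swap)
  also have "\<dots> = (\<Sum>j\<in>UNIV. cnj (x $ j) * (conj_transpose M *v y) $ j)"
    by (simp add: matrix_vector_mult_def conj_transpose_def map_matrix_def transpose_def
        sum_distrib_left mult_ac)
  finally show ?thesis
    by (simp add: inner_complex_vec)
qed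

lemma conj_transpose_conj_transpose [simp]: "conj_transpose (conj_transpose M) = M"
  by (simp add: conj_transpose_def map_matrix_def transpose_def vec_eq_iff)

lemma inner_matrix_right:
  fixes M :: "complex ^ 'm ^ 'n"
  shows "x \<bullet> (M *v y) = (conj_transpose M *v x) \<bullet> y"
  by (simp add: inner_matrix_left)

lemma conj_transpose_eqI:
  fixes M :: "complex ^ 'm ^ 'n"
  assumes "\<And>x y. (M *v x) \<bullet> y = x \<bullet> (N *v y)"
  shows "conj_transpose M = N"
proof -
  have "conj_transpose M *v y = N *v y" for y
    using assms by (metis inner_matrix_left vector_eq_ldot)
  then show ?thesis
    by (simp add: matrix_eq)
qed

lemma HermitianI:
  fixes M :: "complex ^ 'n ^ 'n"
  assumes "\<And>x y. (M *v x) \<bullet> y = x \<bullet> (M *v y)"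
  shows "conj_transpose M = M"
  using assms by (rule conj_transpose_eqI)

lemma Hermitian_inner:
  fixes M :: "complex ^ 'n ^ 'n"
  assumes "conj_transpose M = M"
  shows "(M *v x) \<bullet> y = x \<bullet> (M *v y)"
  by (metis assms inner_matrix_left)

lemma conj_transpose_add: "conj_transpose (M + N) = conj_transpose M + conj_transpose N"
  by (simp add: conj_transpose_def map_matrix_def transpose_def vec_eq_iff)

lemma conj_transpose_diff: "conj_transpose (M - N) = conj_transpose M - conj_transpose N"
  by (simp add: conj_transpose_def map_matrix_def transpose_def vec_eq_iff)

lemma conj_transpose_scaleR: "conj_transpose (r *\<^sub>R M) = r *\<^sub>R conj_transpose M"
  by (simp add: conj_transpose_def map_matrix_def transpose_def vec_eq_iff)

lemma conj_transpose_mat_1 [simp]: "conj_transpose (mat 1) = mat 1"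
  by (auto simp: conj_transpose_def map_matrix_def transpose_def vec_eq_iff mat_def)

lemma conj_transpose_mult:
  fixes M :: "complex ^ 'm ^ 'n" and N :: "complex ^ 'k ^ 'm"
  shows "conj_transpose (M ** N) = conj_transpose N ** conj_transpose M"
  by (rule conj_transpose_eqI) (simp add: inner_matrix_left flip: matrix_vector_mul_assoc)

lemma inner_smult_left:
  fixes x y :: "complex ^ 'n"
  shows "(c *s x) \<bullet> y = x \<bullet> (cnj c *s y)"
  by (simp add: inner_complex_vec mult_ac)

lemma smult_of_real: "complex_of_real r *s x = r *\<^sub>R x"
  by (simp add: vec_eq_iff scaleR_conv_of_real[where 'a = complex])

lemma matrix_scaleR_vec: "(r *\<^sub>R M) *v x = r *\<^sub>R ((M :: complex ^ 'm ^ 'n) *v x)"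
  by (simp add: vec_eq_iff matrix_vector_mult_def scaleR_sum_right)

lemma matrix_vec_smult: "(M :: complex ^ 'm ^ 'n) *v (c *s x) = c *s (M *v x)"
  by (simp add: vec_eq_iff matrix_vector_mult_def sum_distrib_left mult_ac)

lemma matrix_minus_vec: "(- M) *v x = - ((M :: complex ^ 'm ^ 'n) *v x)"
  by (simp add: vec_eq_iff matrix_vector_mult_def sum_negf)

lemma matrix_sum_vec: "(\<Sum>i\<in>S. f i) *v x = (\<Sum>i\<in>S. (f i :: complex ^ 'm ^ 'n) *v x)"
  by (induction S rule: infinite_finite_induct) (auto simp: matrix_vector_mult_add_rdistrib)

lemma linear_matrix: "linear ((*v) (M :: complex ^ 'm ^ 'n))"
  by (simp add: matrix_vector_mul_linear)

lemmas matrix_vec_simps = matrix_vector_right_distrib matrix_vector_mult_diff_distrib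
  matrix_vector_mult_add_rdistrib matrix_vector_mult_diff_rdistrib matrix_minus_vec
  matrix_scaleR_vec linear_neg[OF linear_matrix] linear_cmul[OF linear_matrix]

lemma csubspace_imp_subspace: "vec.subspace U \<Longrightarrow> subspace (U :: (complex ^ 'n) set)"
  unfolding subspace_def vec.subspace_def by (metis smult_of_real)

subsection \<open>Polynomials in a matrix\<close>

definition poly_mat_vec :: "complex ^ 'n ^ 'n \<Rightarrow> complex poly \<Rightarrow> complex ^ 'n \<Rightarrow> complex ^ 'n" where
  "poly_mat_vec M q v = fold_coeffs (\<lambda>a w. a *s v + M *v w) q 0"

lemma poly_mat_vec_0 [simp]: "poly_mat_vec M 0 v = 0"
  by (simp add: poly_mat_vec_def)

lemma poly_mat_vec_pCons [simp]: "poly_mat_vec M (pCons a q) v = a *s v + M *v poly_mat_vec M q v"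
  by (cases "q = 0 \<and> a = 0") (auto simp: poly_mat_vec_def)

lemma poly_mat_vec_add: "poly_mat_vec M (p + q) v = poly_mat_vec M p v + poly_mat_vec M q v"
  by (induction p q rule: poly_induct2) (simp_all add: matrix_vec_simps vec.scale_left_distrib)

lemma poly_mat_vec_smult: "poly_mat_vec M (smult c q) v = c *s poly_mat_vec M q v"
  by (induction q) (simp_all add: matrix_vec_smult vec.scale_right_distrib)

lemma poly_mat_vec_sum: "poly_mat_vec M (\<Sum>i\<in>S. q i) v = (\<Sum>i\<in>S. poly_mat_vec M (q i) v)"
  by (induction S rule: infinite_finite_induct) (auto simp: poly_mat_vec_add)

lemma poly_mat_vec_monom: "poly_mat_vec M (monom c n) v = c *s (((*v) M ^^ n) v)"
  by (induction n) (simp_all add: monom_0 monom_Suc matrix_vec_smult)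

lemma poly_mat_vec_linear_factor:
  "poly_mat_vec M ([:- r, 1:] * q) v = M *v poly_mat_vec M q v - r *s poly_mat_vec M q v"
proof -
  have eq: "[:- r, 1:] * q = smult (- r) q + pCons 0 q"
    by simp
  show ?thesis
    unfolding eq poly_mat_vec_add poly_mat_vec_smult by simp
qed

lemma poly_mat_vec_eigenvector:
  assumes "M *v v = \<nu> *s v"
  shows "poly_mat_vec M q v = poly q \<nu> *s v"
  using assms by (induction q) (simp_all add: matrix_vec_smult vec.scale_left_distrib mult.commute)

lemma sequence_dependent:
  fixes f :: "nat \<Rightarrow> 'a::euclidean_space"
  obtains c :: "nat \<Rightarrow> real" and N where "\<exists>i\<le>N. c i \<noteq> 0" "(\<Sum>i\<le>N. c i *\<^sub>R f i) = 0"
proof -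
  define N where "N = DIM('a)"
  show ?thesis
  proof (cases "inj_on f {..N}")
    case True
    then have "card (f ` {..N}) > DIM('a)"
      by (simp add: card_image N_def)
    then have "dependent (f ` {..N})"
      by (intro dependent_biggerset) auto
    then obtain u where "\<exists>v\<in>f ` {..N}. u v \<noteq> 0" "(\<Sum>v\<in>f ` {..N}. u v *\<^sub>R v) = 0"
      by (auto simp: dependent_finite)
    then show ?thesis
      using that[of N "u \<circ> f"] True by (auto simp: sum.reindex)
  next
    case False
    then obtain i j where ij: "i \<le> N" "j \<le> N" "i \<noteq> j" "f i = f j"
      by (auto simp: inj_on_def)
    have "(\<Sum>k\<le>N. ((if k = i then 1 else 0) - (if k = j then 1 else 0)) *\<^sub>R f k)
        = (\<Sum>k\<le>N. if k = i then f k else 0) - (\<Sum>k\<le>N. if k = j then f k else 0)"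
      unfolding sum_subtractf[symmetric] by (rule sum.cong) auto
    also have "\<dots> = 0"
      using ij by (simp add: sum.delta)
    finally show ?thesis
      using ij by (intro that[of N "\<lambda>k. (if k = i then 1 else 0) - (if k = j then 1 else 0)"]) auto
  qed
qed

lemma annihilating_poly:
  fixes M :: "complex ^ 'n ^ 'n"
  obtains q where "q \<noteq> 0" "\<And>v. poly_mat_vec M q v = 0"
proof -
  define P where "P = (\<lambda>i. ((\<lambda>X. M ** X) ^^ i) (mat 1))"
  have P: "P i *v v = ((*v) M ^^ i) v" for i v
    by (induction i) (simp_all add: P_def flip: matrix_vector_mul_assoc)
  obtain c N where c: "\<exists>i\<le>N. c i \<noteq> 0" "(\<Sum>i\<le>N. c i *\<^sub>R P i) = 0"
    by (rule sequence_dependent)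
  define q where "q = (\<Sum>i\<le>N. monom (complex_of_real (c i)) i)"
  have "poly_mat_vec M q v = (\<Sum>i\<le>N. c i *\<^sub>R P i) *v v" for v
    unfolding q_def poly_mat_vec_sum poly_mat_vec_monom matrix_sum_vec
    by (simp add: smult_of_real matrix_scaleR_vec P)
  then have "poly_mat_vec M q v = 0" for v
    by (simp add: c)
  moreover have "coeff q i = c i" if "i \<le> N" for i
    using that by (simp add: q_def coeff_sum)
  then have "q \<noteq> 0"
    using c(1) by auto
  ultimately show ?thesis
    using that by blast
qed

lemma finite_eigenvalues: "finite (eigenvalues M)"
proof -
  obtain q where q: "q \<noteq> 0" "\<And>v. poly_mat_vec M q v = 0"
    using annihilating_poly[of M] by blast
  have "eigenvalues M \<subseteq> {x. poly q x = 0}"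
  proof (clarsimp simp: eigenvalues_def)
    fix \<nu> v
    assume "v \<noteq> 0" "M *v v = \<nu> *s v"
    then show "poly q \<nu> = 0"
      using q(2)[of v] by (simp add: poly_mat_vec_eigenvector)
  qed
  then show ?thesis
    using poly_roots_finite[OF q(1)] finite_subset by blast
qed

lemma poly_mat_vec_enters_subspace:
  fixes M :: "complex ^ 'n ^ 'n"
  assumes U: "vec.subspace U" and p: "v \<notin> U"
  shows "q \<noteq> 0 \<Longrightarrow> poly_mat_vec M q v \<in> U \<Longrightarrow> \<exists>p \<nu>. p \<notin> U \<and> M *v p - \<nu> *s p \<in> U"
proof (induction "degree q" arbitrary: q)
  case 0
  then obtain a where a: "q = [:a:]" "a \<noteq> 0"
    by (metis degree_eq_zeroE pCons_0_0)
  then have "a *s v \<in> U"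
    using 0 by simp
  then have "inverse a *s (a *s v) \<in> U"
    by (rule vec.subspace_scale[OF U])
  then show ?case
    using a(2) p by simp
next
  case (Suc d)
  then obtain r where "poly q r = 0"
    using fundamental_theorem_of_algebra[of q] by (auto simp: constant_degree)
  then obtain q' where q': "q = [:- r, 1:] * q'"
    by (metis poly_eq_0_iff_dvd dvdE)
  then have nz: "q' \<noteq> 0"
    using Suc by auto
  then have "degree q = Suc (degree q')"
    unfolding q' by (subst degree_mult_eq) auto
  show ?case
  proof (cases "poly_mat_vec M q' v \<in> U")
    case True
    then show ?thesis
      using Suc nz \<open>degree q = Suc (degree q')\<close> by auto
  next
    case False
    then show ?thesis
      using Suc.prems(2) unfolding q' poly_mat_vec_linear_factor by blast
  qed
qed

lemma quotient_eigenvector: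
  fixes M :: "complex ^ 'n ^ 'n"
  assumes U: "vec.subspace U" "U \<noteq> UNIV" and inv: "\<And>u. u \<in> U \<Longrightarrow> M *v u \<in> U"
  obtains p \<nu> where "p \<notin> U" "\<nu> \<in> eigenvalues M" "M *v p - \<nu> *s p \<in> U"
proof -
  obtain q where q: "q \<noteq> 0" "\<And>v. poly_mat_vec M q v = 0"
    using annihilating_poly[of M] by blast
  obtain v where "v \<notin> U"
    using U by blast
  then obtain p \<nu> where p: "p \<notin> U" "M *v p - \<nu> *s p \<in> U"
    using poly_mat_vec_enters_subspace[OF U(1), of v q M] q vec.subspace_0[OF U(1)] by auto
  define g where "g x = M *v x - \<nu> *s x" for x
  have lin: "linear g"
    unfolding g_def by (rule linearI)
      (simp_all add: matrix_vec_simps vec.scale_right_distrib vec_eq_iff algebra_simps)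
  have "\<nu> \<in> eigenvalues M"
  proof (rule ccontr)
    assume "\<nu> \<notin> eigenvalues M"
    then have "g x = 0 \<Longrightarrow> x = 0" for x
      by (auto simp: eigenvalues_def g_def)
    then have "inj g"
      using lin by (simp add: linear_injective_0)
    have sub: "subspace U"
      by (rule csubspace_imp_subspace[OF U(1)])
    have "g ` U \<subseteq> U"
      using U inv by (auto simp: g_def intro!: vec.subspace_diff vec.subspace_scale)
    moreover have "dim (g ` U) = dim U"
      using dim_image_eq[OF lin, of U] \<open>inj g\<close> by (metis inj_on_subset subset_UNIV)
    ultimately have "g ` U = U"
      using sub lin by (intro subspace_dim_equal) (auto simp: linear_subspace_image)
    then have "g p \<in> g ` U"
      using p by (simp add: g_def)
    then show False
      using p(1) \<open>inj g\<close> by (simp add: inj_image_mem_iff)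
  qed
  then show ?thesis
    using p that by blast
qed

lemma eigenvalues_nonempty: "eigenvalues (M :: complex ^ 'n ^ 'n) \<noteq> {}"
proof -
  have "axis undefined 1 \<noteq> (0 :: complex ^ 'n)"
    by (simp add: axis_eq_0_iff)
  then have "{0} \<noteq> (UNIV :: (complex ^ 'n) set)"
    by blast
  then show ?thesis
    by (rule quotient_eigenvector[of "{0}" M, rotated]) auto
qed

subsection \<open>Sylvester equations and Lyapunov's theorem\<close>

lemma spectrum_adjoint:
  assumes "\<nu> \<in> eigenvalues (conj_transpose M)"
  shows "cnj \<nu> \<in> eigenvalues M"
proof (rule ccontr)
  assume neg: "cnj \<nu> \<notin> eigenvalues M"
  obtain v where v: "v \<noteq> 0" "conj_transpose M *v v = \<nu> *s v"
    using assms by (auto simp: eigenvalues_def)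
  define g where "g x = M *v x - cnj \<nu> *s x" for x
  have lin: "linear g"
    unfolding g_def by (rule linearI)
      (simp_all add: matrix_vec_simps vec.scale_right_distrib vec_eq_iff algebra_simps)
  have "g x = 0 \<Longrightarrow> x = 0" for x
    using neg by (auto simp: eigenvalues_def g_def)
  then have "inj g"
    using lin by (simp add: linear_injective_0)
  then have "surj g"
    using lin by (simp add: linear_injective_imp_surjective)
  then obtain x where "g x = v"
    by (metis surj_def)
  have "g x \<bullet> v = x \<bullet> (conj_transpose M *v v) - x \<bullet> (\<nu> *s v)"
    by (simp add: g_def inner_diff_left inner_matrix_left inner_smult_left)
  then show False
    using v \<open>g x = v\<close> by simp
qed

lemma sylvester_unique:
  fixes Z :: "complex ^ 'n ^ 'n"
  assumes K: "stable_matrix K" and L: "stable_matrix L"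
    and eq: "\<And>v. conj_transpose L *v (Z *v v) + Z *v (K *v v) = 0"
  shows "Z = 0"
proof (rule ccontr)
  assume nz: "Z \<noteq> 0"
  define U where "U = {v. Z *v v = 0}"
  have U: "vec.subspace U"
    by (auto simp: U_def vec.subspace_def matrix_vec_simps matrix_vec_smult)
  have "U \<noteq> UNIV"
    using nz by (auto simp: U_def set_eq_iff matrix_eq)
  moreover have "K *v v \<in> U" if "v \<in> U" for v
    using that eq[of v] by (simp add: U_def)
  ultimately obtain p \<nu> where p: "p \<notin> U" "\<nu> \<in> eigenvalues K" "K *v p - \<nu> *s p \<in> U"
    using quotient_eigenvector[OF U, of K] by blast
  have "Z *v (K *v p) = \<nu> *s (Z *v p)"
    using p(3) by (simp add: U_def matrix_vec_simps matrix_vec_smult)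
  then have "conj_transpose L *v (Z *v p) = (- \<nu>) *s (Z *v p)"
    using eq[of p] by (simp add: eq_neg_iff_add_eq_0 vec.scale_minus_left)
  moreover have "Z *v p \<noteq> 0"
    using p(1) by (simp add: U_def)
  ultimately have "- \<nu> \<in> eigenvalues (conj_transpose L)"
    by (auto simp: eigenvalues_def)
  then have "Re (cnj (- \<nu>)) < 0"
    using L spectrum_adjoint unfolding stable_matrix_def by blast
  moreover have "Re \<nu> < 0"
    using K p(2) by (simp add: stable_matrix_def)
  ultimately show False
    by simp
qed

lemma nondegenerate_decomp:
  fixes W :: "'a::euclidean_space \<Rightarrow> 'a"
  assumes W: "linear W" and U: "subspace U"
    and pos: "\<And>u. u \<in> U \<Longrightarrow> u \<noteq> 0 \<Longrightarrow> u \<bullet> W u \<noteq> 0"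
  obtains u where "u \<in> U" "\<And>u'. u' \<in> U \<Longrightarrow> (x - u) \<bullet> W u' = 0"
proof -
  define T where "T = {y. \<forall>u\<in>U. orthogonal (W u) y}"
  define S where "S = {a + b |a b. a \<in> U \<and> b \<in> T}"
  have T: "subspace T"
    unfolding T_def subspace_def orthogonal_def by (simp add: inner_add_right)
  have "y = 0" if "y \<in> U" "y \<in> T" for y
  proof -
    have "W y \<bullet> y = 0"
      using that by (simp add: T_def orthogonal_def)
    then show ?thesis
      using pos[OF that(1)] by (metis inner_commute)
  qed
  then have "U \<inter> T \<subseteq> {0}"
    by blast
  then have 1: "dim (U \<inter> T) = 0"
    by (simp only: dim_eq_0)
  have "dim {y \<in> UNIV. \<forall>x\<in>W ` U. orthogonal x y} + dim (W ` U) = dim (UNIV :: 'a set)"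
    using W U by (intro dim_subspace_orthogonal_to_vectors linear_subspace_image) simp_all
  moreover have "{y \<in> UNIV. \<forall>x\<in>W ` U. orthogonal x y} = T"
    by (simp add: T_def)
  ultimately have 2: "dim T + dim (W ` U) = DIM('a)"
    by simp
  have 3: "dim S + dim (U \<inter> T) = dim U + dim T"
    unfolding S_def by (rule dim_sums_Int[OF U T])
  have "dim (W ` U) \<le> dim U"
    using W by (rule dim_image_le)
  then have "DIM('a) \<le> dim S"
    using 1 2 3 by linarith
  moreover have "dim S \<le> DIM('a)"
    by (rule dim_subset_UNIV)
  ultimately have "span S = UNIV"
    by (simp only: dim_eq_full[symmetric] order_antisym)
  moreover have "subspace S"
    unfolding S_def using U T by (rule subspace_sums)
  ultimately have "S = UNIV"
    using span_eq_iff by blast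
  then have "x \<in> S"
    by simp
  then obtain a b where ab: "x = a + b" "a \<in> U" "b \<in> T"
    unfolding S_def by blast
  show ?thesis
  proof (rule that[of a])
    show "(x - a) \<bullet> W u' = 0" if "u' \<in> U" for u'
      using ab that by (simp add: T_def orthogonal_def inner_commute)
  qed (rule ab)
qed

lemma inner_smult_Hermitian:
  assumes W: "conj_transpose W = W"
  shows "p \<bullet> (c *s (W *v p)) = Re c * (p \<bullet> (W *v p))"
proof -
  have "p \<bullet> (\<i> *s (W *v p)) = (W *v (cnj \<i> *s p)) \<bullet> p"
    by (metis inner_smult_left Hermitian_inner[OF W] complex_cnj_cnj)
  also have "\<dots> = - (p \<bullet> (\<i> *s (W *v p)))"
    by (simp add: matrix_vec_simps matrix_vec_smult inner_commute)
  finally have "p \<bullet> (\<i> *s (W *v p)) = 0"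
    by simp
  moreover have "c *s (W *v p) = Re c *\<^sub>R (W *v p) + Im c *\<^sub>R (\<i> *s (W *v p))"
    by (simp add: vec_eq_iff complex_eq_iff)
  ultimately show ?thesis
    by (simp add: inner_add_right)
qed

text \<open>Take a \<open>M\<close>-invariant subspace \<open>U\<close> of maximal dimension on which the form is positive.  If
  \<open>U\<close> is proper, an eigenvector of \<open>M\<close> modulo \<open>U\<close>, chosen \<open>W\<close>-orthogonal to \<open>U\<close>, can be added
  to it.\<close>

lemma lyapunov_positive:
  fixes M W :: "complex ^ 'n ^ 'n"
  assumes W: "conj_transpose W = W"
    and M: "\<And>\<nu>. \<nu> \<in> eigenvalues M \<Longrightarrow> Re \<nu> \<le> 0"
    and neg: "\<And>v. v \<noteq> 0 \<Longrightarrow> (W *v v) \<bullet> (M *v v) < 0"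
    and "v \<noteq> 0"
  shows "v \<bullet> (W *v v) > 0"
proof -
  define good where "good U \<longleftrightarrow> vec.subspace U \<and> (\<forall>u\<in>U. M *v u \<in> U) \<and>
    (\<forall>u\<in>U. u \<noteq> 0 \<longrightarrow> u \<bullet> (W *v u) > 0)" for U
  note sym = Hermitian_inner[OF W]
  have extend: "\<exists>V. good V \<and> dim V > dim U" if U: "good U" "U \<noteq> UNIV" for U
  proof -
    have cs: "vec.subspace U" and inv: "\<And>u. u \<in> U \<Longrightarrow> M *v u \<in> U"
      and pos: "\<And>u. u \<in> U \<Longrightarrow> u \<noteq> 0 \<Longrightarrow> u \<bullet> (W *v u) > 0"
      using U by (auto simp: good_def)
    obtain q \<nu> where q: "q \<notin> U" "\<nu> \<in> eigenvalues M" "M *v q - \<nu> *s q \<in> U"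
      using quotient_eigenvector[OF cs U(2), of M] inv by blast
    obtain u where u: "u \<in> U" and "\<And>u'. u' \<in> U \<Longrightarrow> (q - u) \<bullet> (W *v u') = 0"
      using nondegenerate_decomp[OF linear_matrix csubspace_imp_subspace[OF cs], of W q] pos
      by (metis less_irrefl)
    define p where "p = q - u"
    have orth: "p \<bullet> (W *v u') = 0" if "u' \<in> U" for u'
      using \<open>\<And>u'. u' \<in> U \<Longrightarrow> (q - u) \<bullet> (W *v u') = 0\<close> that by (simp add: p_def)
    have pU: "p \<notin> U"
      using q(1) u vec.subspace_add[OF cs, of p u] by (auto simp: p_def)
    then have "p \<noteq> 0"
      using vec.subspace_0[OF cs] by auto
    define w where "w = M *v p - \<nu> *s p"
    have "w = (M *v q - \<nu> *s q) - (M *v u - \<nu> *s u)"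
      by (simp add: w_def p_def matrix_vec_simps vec.scale_right_diff_distrib)
    then have wU: "w \<in> U"
      using q(3) u inv by (auto intro!: vec.subspace_diff[OF cs] vec.subspace_scale[OF cs])
    have "(W *v p) \<bullet> (M *v p) = (W *v p) \<bullet> (\<nu> *s p) + (W *v p) \<bullet> w"
      by (simp add: w_def inner_diff_right)
    also have "(W *v p) \<bullet> w = 0"
      using orth[OF wU] by (simp add: sym)
    also have "(W *v p) \<bullet> (\<nu> *s p) = Re \<nu> * (p \<bullet> (W *v p))"
      by (simp add: sym matrix_vec_smult inner_smult_Hermitian[OF W])
    finally have "Re \<nu> * (p \<bullet> (W *v p)) < 0"
      using neg[OF \<open>p \<noteq> 0\<close>] by simp
    then have posp: "p \<bullet> (W *v p) > 0"
      using M[OF q(2)] by (simp add: mult_less_0_iff)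
    define V where "V = {u + c *s p | u c. u \<in> U}"
    have csV: "vec.subspace V"
      unfolding vec.subspace_def
    proof (intro conjI ballI allI)
      show "0 \<in> V"
        using vec.subspace_0[OF cs] by (force simp: V_def intro: exI[of _ 0])
    next
      fix x y assume "x \<in> V" "y \<in> V"
      then obtain u c u' c' where "x = u + c *s p" "y = u' + c' *s p" "u \<in> U" "u' \<in> U"
        by (auto simp: V_def)
      then have "x + y = (u + u') + (c + c') *s p" "u + u' \<in> U"
        by (auto simp: vec.scale_left_distrib intro: vec.subspace_add[OF cs])
      then show "x + y \<in> V"
        unfolding V_def by blast
    next
      fix x d assume "x \<in> V"
      then obtain u c where "x = u + c *s p" "u \<in> U"
        by (auto simp: V_def)
      then have "d *s x = d *s u + (d * c) *s p" "d *s u \<in> U"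
        by (auto simp: vec.scale_right_distrib intro: vec.subspace_scale[OF cs])
      then show "d *s x \<in> V"
        unfolding V_def by blast
    qed
    have "M *v x \<in> V" if x: "x \<in> V" for x
    proof -
      obtain u c where x: "x = u + c *s p" "u \<in> U"
        using x by (auto simp: V_def)
      have "M *v x = M *v u + c *s w + (c * \<nu>) *s p"
        by (simp add: x w_def matrix_vec_simps matrix_vec_smult vec.scale_right_diff_distrib)
      moreover have "M *v u + c *s w \<in> U"
        using x inv wU by (auto intro!: vec.subspace_add[OF cs] vec.subspace_scale[OF cs])
      ultimately show ?thesis
        unfolding V_def by blast
    qed
    moreover have "x \<bullet> (W *v x) > 0" if x: "x \<in> V" "x \<noteq> 0" for x
    proof -
      obtain u c where xe: "x = u + c *s p" "u \<in> U"
        using x by (auto simp: V_def)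
      have 1: "(c *s p) \<bullet> (W *v u) = 0"
        using orth[of "cnj c *s u"] xe(2) vec.subspace_scale[OF cs]
        by (simp add: inner_smult_left matrix_vec_smult)
      then have 2: "u \<bullet> (W *v (c *s p)) = 0"
        by (metis sym inner_commute)
      have "(c *s p) \<bullet> (W *v (c *s p)) = p \<bullet> ((cnj c * c) *s (W *v p))"
        by (simp add: inner_smult_left matrix_vec_smult)
      also have "\<dots> = (cmod c)\<^sup>2 * (p \<bullet> (W *v p))"
        using cmod_power2[of c] by (simp add: inner_smult_Hermitian[OF W] power2_eq_square)
      finally have "x \<bullet> (W *v x) = u \<bullet> (W *v u) + (cmod c)\<^sup>2 * (p \<bullet> (W *v p))"
        using 1 2 by (simp add: xe matrix_vec_simps inner_add_left inner_add_right)
      moreover have "u = 0 \<longrightarrow> c \<noteq> 0"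
        using x(2) xe by auto
      ultimately show ?thesis
        using pos[OF xe(2)] posp
        by (cases "u = 0"; cases "c = 0") (simp_all add: add_pos_pos)
    qed
    ultimately have "good V"
      using csV by (simp add: good_def)
    moreover have "U \<subset> V"
    proof -
      have "U \<subseteq> V"
        by (force simp: V_def intro: exI[of _ 0])
      moreover have "p \<in> V"
        using vec.subspace_0[OF cs] by (force simp: V_def intro: exI[of _ 0] exI[of _ 1])
      ultimately show ?thesis
        using pU by blast
    qed
    then have "dim U < dim V"
      using csubspace_imp_subspace[OF cs] csubspace_imp_subspace[OF csV]
      by (intro dim_psubset) (metis span_eq_iff)
    ultimately show ?thesis
      by blast
  qed
  have "good {0}"
    by (simp add: good_def)
  then obtain U where U: "good U" and max: "\<And>V. good V \<Longrightarrow> dim V \<le> dim U"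
    using ex_has_greatest_nat[of good "{0}" dim "Suc (DIM(complex ^ 'n))"]
    by (metis dim_subset_UNIV less_Suc_eq_le)
  then have "U = UNIV"
    using extend[of U] by (metis not_less)
  then show ?thesis
    using U \<open>v \<noteq> 0\<close> by (auto simp: good_def)
qed

lemma conj_transpose_minus: "conj_transpose (- M) = - conj_transpose M"
  by (simp add: conj_transpose_def map_matrix_def transpose_def vec_eq_iff)

lemma lyapunov_form:
  assumes "conj_transpose X = X"
  shows "v \<bullet> (conj_transpose K *v (X *v v) + X *v (K *v v)) = 2 * ((X *v v) \<bullet> (K *v v))"
  by (simp add: inner_add_right inner_matrix_left[of K v, symmetric]
      Hermitian_inner[OF assms, symmetric, of v] inner_commute[of "K *v v"])

lemma lyapunov_stable:
  assumes "conj_transpose X = X" and nonneg: "\<And>v. 0 \<le> v \<bullet> (X *v v)"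
    and neg: "\<And>v. v \<noteq> 0 \<Longrightarrow> (X *v v) \<bullet> (K *v v) < 0"
  shows "stable_matrix K"
  unfolding stable_matrix_def
proof
  fix \<nu> assume "\<nu> \<in> eigenvalues K"
  then obtain v where v: "v \<noteq> 0" "K *v v = \<nu> *s v"
    by (auto simp: eigenvalues_def)
  have "Re \<nu> * (v \<bullet> (X *v v)) = (X *v v) \<bullet> (K *v v)"
    using assms(1) by (simp add: v Hermitian_inner inner_smult_Hermitian matrix_vec_smult)
  then have "Re \<nu> * (v \<bullet> (X *v v)) < 0"
    using neg[OF v(1)] by simp
  then show "Re \<nu> < 0"
    using nonneg[of v] by (auto simp: mult_less_0_iff)
qed

lemma lyapunov_equation_solvable:
  fixes K Q :: "complex ^ 'n ^ 'n"
  assumes K: "stable_matrix K" and Q: "conj_transpose Q = Q"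
  obtains X where "conj_transpose X = X"
    "\<And>v. conj_transpose K *v (X *v v) + X *v (K *v v) = - (Q *v v)"
proof -
  define L where "L X = conj_transpose K ** X + X ** K" for X
  have L: "L X *v v = conj_transpose K *v (X *v v) + X *v (K *v v)" for X v
    by (simp add: L_def matrix_vec_simps flip: matrix_vector_mul_assoc)
  have lin: "linear L"
    by (rule linearI) (auto simp: matrix_eq L matrix_vec_simps algebra_simps)
  have inj: "X = 0" if "L X = 0" for X
    using that by (intro sylvester_unique[OF K K]) (simp flip: L)
  then have "surj L"
    using lin by (simp add: linear_injective_0 linear_injective_imp_surjective)
  then obtain X where X: "L X = - Q"
    by (metis surj_def)
  have "L (conj_transpose X) = conj_transpose (L X)"
    by (simp add: L_def conj_transpose_add conj_transpose_mult add.commute)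
  also have "\<dots> = L X"
    using Q by (simp add: X conj_transpose_minus)
  finally have "L (conj_transpose X - X) = 0"
    using lin by (simp add: linear_diff)
  then have "conj_transpose X = X"
    using inj by force
  then show ?thesis
    using that[of X] L[of X] by (simp add: X matrix_vec_simps)
qed

lemma lyapunov_nonneg:
  fixes K X :: "complex ^ 'n ^ 'n"
  assumes K: "stable_matrix K" and X: "conj_transpose X = X"
    and nonpos: "\<And>v. (X *v v) \<bullet> (K *v v) \<le> 0"
  shows "0 \<le> v \<bullet> (X *v v)"
proof (rule ccontr)
  assume neg: "\<not> 0 \<le> v \<bullet> (X *v v)"
  then have "v \<noteq> 0"
    by auto
  obtain Y where Y: "conj_transpose Y = Y"
    "\<And>v. conj_transpose K *v (Y *v v) + Y *v (K *v v) = - (mat 1 *v v)"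
    using lyapunov_equation_solvable[OF K conj_transpose_mat_1] by blast
  have Re_le: "Re \<nu> \<le> 0" if "\<nu> \<in> eigenvalues K" for \<nu>
    using K that by (auto simp: stable_matrix_def intro: less_imp_le)
  have YK: "(Y *v w) \<bullet> (K *v w) < 0" if "w \<noteq> 0" for w
  proof -
    have "2 * ((Y *v w) \<bullet> (K *v w)) = - (w \<bullet> w)"
      using lyapunov_form[OF Y(1), of w K] by (simp add: Y(2))
    moreover have "w \<bullet> w > 0"
      using that by simp
    ultimately show ?thesis
      by linarith
  qed
  have posY: "v \<bullet> (Y *v v) > 0"
    using lyapunov_positive[OF Y(1) Re_le YK \<open>v \<noteq> 0\<close>] by simp
  define \<epsilon> where "\<epsilon> = - (v \<bullet> (X *v v)) / (v \<bullet> (Y *v v))"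
  have "\<epsilon> > 0"
    using neg posY by (auto simp: \<epsilon>_def not_le divide_neg_pos)
  define W where "W = X + \<epsilon> *\<^sub>R Y"
  have "conj_transpose W = W"
    by (simp add: W_def conj_transpose_add conj_transpose_scaleR X Y)
  moreover have "(W *v w) \<bullet> (K *v w) < 0" if "w \<noteq> 0" for w
    using nonpos[of w] mult_pos_neg[OF \<open>\<epsilon> > 0\<close> YK[OF that]]
    by (simp add: W_def matrix_vec_simps inner_add_left)
  ultimately have "v \<bullet> (W *v v) > 0"
    using lyapunov_positive[OF _ Re_le _ \<open>v \<noteq> 0\<close>] by blast
  moreover have "v \<bullet> (W *v v) = v \<bullet> (X *v v) + \<epsilon> * (v \<bullet> (Y *v v))"
    by (simp add: W_def matrix_vec_simps inner_add_right)
  moreover have "\<epsilon> * (v \<bullet> (Y *v v)) = - (v \<bullet> (X *v v))"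
    using posY by (simp add: \<epsilon>_def)
  ultimately show False
    by simp
qed

subsection \<open>The Riccati equation\<close>

lemma riccati_equation_iff:
  "riccati_equation A B X \<longleftrightarrow>
    (\<forall>v. X *v (B *v (conj_transpose B *v (X *v v))) - X *v (A *v v)
       - conj_transpose A *v (X *v v) - v = 0)"
  by (simp add: riccati_equation_def matrix_eq matrix_vec_simps flip: matrix_vector_mul_assoc)

lemma closed_loop_vec:
  "(A - B ** (conj_transpose B ** X)) *v v = A *v v - B *v (conj_transpose B *v (X *v v))"
  by (simp add: matrix_vec_simps flip: matrix_vector_mul_assoc)

lemma riccati_dissipation:
  assumes X: "conj_transpose X = X" and eq: "riccati_equation A B X"
  shows "2 * ((X *v v) \<bullet> (A *v v - B *v (conj_transpose B *v (X *v v))))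
    = - ((norm v)\<^sup>2 + (norm (conj_transpose B *v (X *v v)))\<^sup>2)"
proof -
  have "v \<bullet> (X *v (B *v (conj_transpose B *v (X *v v))) - X *v (A *v v)
       - conj_transpose A *v (X *v v) - v) = 0"
    using eq by (simp add: riccati_equation_iff)
  then show ?thesis
    by (simp add: inner_diff_right inner_matrix_right[of v] inner_matrix_right[of _ B] X
        power2_norm_eq_inner) (simp add: inner_commute)
qed

lemma riccati_stable:
  assumes X: "nonneg_Hermitian X" and eq: "riccati_equation A B X"
  shows "stable_matrix (A - B ** (conj_transpose B ** X))"
proof (rule lyapunov_stable)
  show herm: "conj_transpose X = X" and "0 \<le> v \<bullet> (X *v v)" for v
    using X by (auto simp: nonneg_Hermitian_def)
  fix v :: "complex ^ 'a" assume "v \<noteq> 0"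
  then have "(norm v)\<^sup>2 > 0"
    by simp
  then show "(X *v v) \<bullet> ((A - B ** (conj_transpose B ** X)) *v v) < 0"
    using riccati_dissipation[OF herm eq, of v]
      zero_le_power2[of "norm (conj_transpose B *v (X *v v))"]
    unfolding closed_loop_vec by linarith
qed

lemma riccati_unique:
  assumes X: "nonneg_Hermitian X" "riccati_equation A B X"
    and Y: "nonneg_Hermitian Y" "riccati_equation A B Y"
  shows "X = Y"
proof -
  let ?P = "\<lambda>x. B *v (conj_transpose B *v x)"
  have hX: "conj_transpose X = X"
    using X by (simp add: nonneg_Hermitian_def)
  have adj: "conj_transpose (A - B ** (conj_transpose B ** X)) *v x
      = conj_transpose A *v x - X *v ?P x" for x
    by (simp add: conj_transpose_diff conj_transpose_mult hX matrix_vec_simps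
        flip: matrix_vector_mul_assoc)
  have "X - Y = 0"
  proof (rule sylvester_unique[OF riccati_stable[OF Y] riccati_stable[OF X]])
    fix v
    have "X *v (?P (X *v v)) - X *v (A *v v) - conj_transpose A *v (X *v v) - v = 0"
      "Y *v (?P (Y *v v)) - Y *v (A *v v) - conj_transpose A *v (Y *v v) - v = 0"
      using X Y by (simp_all add: riccati_equation_iff)
    then show "conj_transpose (A - B ** (conj_transpose B ** X)) *v ((X - Y) *v v) +
         (X - Y) *v ((A - B ** (conj_transpose B ** Y)) *v v) = 0"
      unfolding adj closed_loop_vec by (simp add: matrix_vec_simps algebra_simps)
  qed
  then show ?thesis
    by simp
qed

lemma tendsto_matrix_vec:
  fixes X :: "nat \<Rightarrow> complex ^ 'm ^ 'n"
  assumes "X \<longlonglongrightarrow> L" "f \<longlonglongrightarrow> l"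
  shows "(\<lambda>k. X k *v f k) \<longlonglongrightarrow> L *v l"
  unfolding matrix_vector_mult_def
  by (intro vec_tendstoI) (auto intro!: tendsto_intros assms)

lemma convergent_matrix:
  fixes X :: "nat \<Rightarrow> complex ^ 'm ^ 'n"
  assumes "\<And>v w. convergent (\<lambda>k. v \<bullet> (X k *v w))"
  obtains L where "X \<longlonglongrightarrow> L"
proof -
  have "\<exists>l. (\<lambda>k. X k $ i $ j) \<longlonglongrightarrow> l" for i j
  proof -
    have "(X k *v axis j 1) $ i = X k $ i $ j" for k
      by (simp add: matrix_vector_mult_def axis_def if_distrib cong: if_cong)
    then have entry: "axis i a \<bullet> (X k *v axis j 1) = a \<bullet> (X k $ i $ j)" for a k
      by (simp add: inner_axis')
    obtain r s where "(\<lambda>k. 1 \<bullet> (X k $ i $ j)) \<longlonglongrightarrow> r" "(\<lambda>k. \<i> \<bullet> (X k $ i $ j)) \<longlonglongrightarrow> s"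
      using assms[of "axis i 1" "axis j 1"] assms[of "axis i \<i>" "axis j 1"]
      unfolding entry convergent_def by blast
    then have "(\<lambda>k. X k $ i $ j) \<longlonglongrightarrow> Complex r s"
      by (simp add: tendsto_complex_iff inner_complex_def)
    then show ?thesis
      by blast
  qed
  then obtain l where "\<And>i j. (\<lambda>k. X k $ i $ j) \<longlonglongrightarrow> l i j"
    by metis
  then have "X \<longlonglongrightarrow> (\<chi> i j. l i j)"
    by (intro vec_tendstoI) simp
  then show ?thesis
    by (rule that)
qed

lemma Hermitian_polarization:
  assumes "conj_transpose X = X"
  shows "v \<bullet> (X *v w) = ((v + w) \<bullet> (X *v (v + w)) - (v - w) \<bullet> (X *v (v - w))) / 4"
  using Hermitian_inner[OF assms, of w v]
  by (simp add: matrix_vec_simps inner_add_left inner_add_right inner_diff_left inner_diff_right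
      inner_commute)

lemma decreasing_Hermitian_convergent:
  fixes X :: "nat \<Rightarrow> complex ^ 'n ^ 'n"
  assumes X: "\<And>k. conj_transpose (X k) = X k" and nonneg: "\<And>k v. 0 \<le> v \<bullet> (X k *v v)"
    and dec: "\<And>k v. v \<bullet> (X (Suc k) *v v) \<le> v \<bullet> (X k *v v)"
  obtains L where "X \<longlonglongrightarrow> L"
proof (rule convergent_matrix)
  have q: "convergent (\<lambda>k. v \<bullet> (X k *v v))" for v
  proof (rule decseq_convergent)
    show "decseq (\<lambda>k. v \<bullet> (X k *v v))"
      using dec by (simp add: decseq_Suc_iff)
  qed (use nonneg in \<open>auto simp: convergent_def\<close>)
  show "convergent (\<lambda>k. v \<bullet> (X k *v w))" for v w
    unfolding Hermitian_polarization[OF X, of v _ w] divide_inverse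
    by (intro convergent_mult convergent_diff q convergent_const)
qed (rule that)

text \<open>The invariant of Kleinman's iteration, which replaces \<open>X\<close> by the cost of the gain
  \<open>B\<^sup>* X\<close>.\<close>

definition stabilizing_cost where
  "stabilizing_cost A B X \<longleftrightarrow> nonneg_Hermitian X \<and>
    stable_matrix (A - B ** (conj_transpose B ** X)) \<and>
    (\<forall>v. 2 * ((X *v v) \<bullet> (A *v v - B *v (conj_transpose B *v (X *v v))))
      \<le> - ((norm v)\<^sup>2 + (norm (conj_transpose B *v (X *v v)))\<^sup>2))"

lemma feedback_cost:
  fixes A :: "complex ^ 'n ^ 'n" and B :: "complex ^ 'm ^ 'n" and F :: "complex ^ 'n ^ 'm"
  assumes st: "stable_matrix (A - B ** F)"
  obtains X where "stabilizing_cost A B X"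
    "\<And>v. conj_transpose (A - B ** F) *v (X *v v) + X *v ((A - B ** F) *v v)
      = - (v + conj_transpose F *v (F *v v))"
    "\<And>v. 2 * ((X *v v) \<bullet> ((A - B ** F) *v v)) = - ((norm v)\<^sup>2 + (norm (F *v v))\<^sup>2)"
proof -
  define K where "K = A - B ** F"
  have "conj_transpose (mat 1 + conj_transpose F ** F) = mat 1 + conj_transpose F ** F"
    by (simp add: conj_transpose_add conj_transpose_mult)
  then obtain X where X: "conj_transpose X = X" and
    "\<And>v. conj_transpose K *v (X *v v) + X *v (K *v v) = - ((mat 1 + conj_transpose F ** F) *v v)"
    using lyapunov_equation_solvable[of K] st unfolding K_def by blast
  then have eq: "conj_transpose K *v (X *v v) + X *v (K *v v)
      = - (v + conj_transpose F *v (F *v v))" for v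
    by (simp add: matrix_vec_simps matrix_vector_mul_assoc)
  have diss: "2 * ((X *v v) \<bullet> (K *v v)) = - ((norm v)\<^sup>2 + (norm (F *v v))\<^sup>2)" for v
  proof -
    have "2 * ((X *v v) \<bullet> (K *v v)) = - (v \<bullet> v + v \<bullet> (conj_transpose F *v (F *v v)))"
      by (simp add: lyapunov_form[OF X, symmetric] eq inner_add_right inner_diff_right)
    then show ?thesis
      by (simp add: inner_matrix_left[symmetric] power2_norm_eq_inner)
  qed
  have nonneg: "0 \<le> v \<bullet> (X *v v)" for v
  proof (rule lyapunov_nonneg[OF _ X])
    show "stable_matrix K"
      using st by (simp add: K_def)
    show "(X *v v) \<bullet> (K *v v) \<le> 0" for v
      using diss[of v] zero_le_power2[of "norm v"] zero_le_power2[of "norm (F *v v)"] by linarith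
  qed
  have diss': "2 * ((X *v v) \<bullet> (A *v v - B *v (conj_transpose B *v (X *v v))))
      \<le> - ((norm v)\<^sup>2 + (norm (conj_transpose B *v (X *v v)))\<^sup>2)" for v
  proof -
    define G where "G = conj_transpose B *v (X *v v)"
    have "A *v v - B *v G = K *v v + B *v (F *v v - G)"
      by (simp add: K_def matrix_vec_simps flip: matrix_vector_mul_assoc)
    then have "2 * ((X *v v) \<bullet> (A *v v - B *v G))
        = - ((norm v)\<^sup>2 + (norm (F *v v))\<^sup>2) + 2 * (G \<bullet> (F *v v - G))"
      by (simp add: inner_add_right diss inner_matrix_right[of _ B] G_def)
    also have "\<dots> = - ((norm v)\<^sup>2 + (norm G)\<^sup>2 + (norm (F *v v - G))\<^sup>2)"
      by (simp add: power2_norm_eq_inner inner_diff_left inner_diff_right inner_commute)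
    finally show ?thesis
      using zero_le_power2[of "norm (F *v v - G)"] by (simp add: G_def)
  qed
  have "stable_matrix (A - B ** (conj_transpose B ** X))"
  proof (rule lyapunov_stable[OF X nonneg])
    fix v :: "complex ^ 'n" assume "v \<noteq> 0"
    then have "(norm v)\<^sup>2 > 0"
      by simp
    then show "(X *v v) \<bullet> ((A - B ** (conj_transpose B ** X)) *v v) < 0"
      using diss'[of v] zero_le_power2[of "norm (conj_transpose B *v (X *v v))"]
      unfolding closed_loop_vec by linarith
  qed
  then have "stabilizing_cost A B X"
    using X nonneg diss' by (simp add: stabilizing_cost_def nonneg_Hermitian_def)
  then show ?thesis
    using that eq diss unfolding K_def by blast
qed

lemma riccati_exists:
  fixes A :: "complex ^ 'n ^ 'n" and B :: "complex ^ 'm ^ 'n"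
  assumes "stabilizable A B"
  obtains X where "nonneg_Hermitian X" "riccati_equation A B X"
proof -
  let ?P = "\<lambda>x. B *v (conj_transpose B *v x)"
  let ?step = "\<lambda>X Y. (\<forall>v. v \<bullet> (Y *v v) \<le> v \<bullet> (X *v v)) \<and>
    (\<forall>v. conj_transpose A *v (Y *v v) - X *v (?P (Y *v v)) + Y *v (A *v v - ?P (X *v v))
      = - (v + X *v (?P (X *v v))))"
  have step: "\<exists>Y. stabilizing_cost A B Y \<and> ?step X Y" if X: "stabilizing_cost A B X" for X
  proof -
    define F where "F = conj_transpose B ** X"
    have hX: "conj_transpose X = X"
      using X by (simp add: stabilizing_cost_def nonneg_Hermitian_def)
    have st: "stable_matrix (A - B ** F)"
      using X by (simp add: stabilizing_cost_def F_def)
    obtain Y where Y: "stabilizing_cost A B Y"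
      and eq: "\<And>v. conj_transpose (A - B ** F) *v (Y *v v) + Y *v ((A - B ** F) *v v)
        = - (v + conj_transpose F *v (F *v v))"
      and diss: "\<And>v. 2 * ((Y *v v) \<bullet> ((A - B ** F) *v v)) = - ((norm v)\<^sup>2 + (norm (F *v v))\<^sup>2)"
      using feedback_cost[OF st] by blast
    have hY: "conj_transpose Y = Y"
      using Y by (simp add: stabilizing_cost_def nonneg_Hermitian_def)
    have adj: "conj_transpose (A - B ** F) *v x = conj_transpose A *v x - X *v ?P x" for x
      by (simp add: F_def conj_transpose_diff conj_transpose_mult hX matrix_vec_simps
          flip: matrix_vector_mul_assoc)
    have loop: "(A - B ** F) *v v = A *v v - ?P (X *v v)" for v
      by (simp add: F_def closed_loop_vec)
    have cost: "conj_transpose F *v (F *v v) = X *v ?P (X *v v)" for v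
      by (simp add: F_def conj_transpose_mult hX flip: matrix_vector_mul_assoc)
    have "conj_transpose A *v (Y *v v) - X *v (?P (Y *v v)) + Y *v (A *v v - ?P (X *v v))
        = - (v + X *v (?P (X *v v)))" for v
      using eq[of v] unfolding adj loop cost .
    moreover have "v \<bullet> (Y *v v) \<le> v \<bullet> (X *v v)" for v
    proof -
      have "0 \<le> v \<bullet> ((X - Y) *v v)"
      proof (rule lyapunov_nonneg[OF st])
        show "conj_transpose (X - Y) = X - Y"
          by (simp add: conj_transpose_diff hX hY)
        fix v
        have "2 * ((X *v v) \<bullet> ((A - B ** F) *v v)) \<le> - ((norm v)\<^sup>2 + (norm (F *v v))\<^sup>2)"
          using X by (simp add: stabilizing_cost_def F_def closed_loop_vec matrix_vector_mul_assoc)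
        then show "((X - Y) *v v) \<bullet> ((A - B ** F) *v v) \<le> 0"
          using diss[of v] by (simp add: matrix_vector_mult_diff_rdistrib inner_diff_left)
      qed
      then show ?thesis
        by (simp add: matrix_vec_simps inner_diff_right)
    qed
    ultimately show ?thesis
      using Y by blast
  qed
  obtain F where "stable_matrix (A - B ** F)"
    using assms by (auto simp: stabilizable_def)
  then obtain X0 where "stabilizing_cost A B X0"
    using feedback_cost by blast
  then obtain X where X: "\<And>k. stabilizing_cost A B (X k)" "\<And>k. ?step (X k) (X (Suc k))"
    using dependent_nat_choice[of "\<lambda>_. stabilizing_cost A B" "\<lambda>_. ?step"] step by blast
  have herm: "conj_transpose (X k) = X k" and nonneg: "0 \<le> v \<bullet> (X k *v v)" for k v
    using X(1)[of k] by (auto simp: stabilizing_cost_def nonneg_Hermitian_def)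
  obtain L where L: "X \<longlonglongrightarrow> L"
    using decreasing_Hermitian_convergent[of X] herm nonneg X(2) by blast
  then have L': "(\<lambda>k. X (Suc k)) \<longlonglongrightarrow> L"
    by (rule LIMSEQ_Suc)
  note lim = tendsto_matrix_vec[OF L] tendsto_matrix_vec[OF L'] tendsto_matrix_vec[OF tendsto_const]
  have "riccati_equation A B L"
    unfolding riccati_equation_iff
  proof
    fix v
    have "(\<lambda>k. conj_transpose A *v (X (Suc k) *v v) - X k *v (?P (X (Suc k) *v v))
        + X (Suc k) *v (A *v v - ?P (X k *v v))) \<longlonglongrightarrow>
      conj_transpose A *v (L *v v) - L *v (?P (L *v v)) + L *v (A *v v - ?P (L *v v))"
      by (intro tendsto_intros lim)
    moreover have "(\<lambda>k. - (v + X k *v (?P (X k *v v)))) \<longlonglongrightarrow> - (v + L *v (?P (L *v v)))"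
      by (intro tendsto_intros lim)
    moreover have "conj_transpose A *v (X (Suc k) *v v) - X k *v (?P (X (Suc k) *v v))
        + X (Suc k) *v (A *v v - ?P (X k *v v)) = - (v + X k *v (?P (X k *v v)))" for k
      using X(2) by blast
    ultimately have "conj_transpose A *v (L *v v) - L *v (?P (L *v v)) + L *v (A *v v - ?P (L *v v))
        = - (v + L *v (?P (L *v v)))"
      by (simp only: LIMSEQ_unique)
    then show "L *v (?P (L *v v)) - L *v (A *v v) - conj_transpose A *v (L *v v) - v = 0"
      by (simp add: matrix_vec_simps algebra_simps)
  qed
  moreover have "conj_transpose L = L"
  proof (rule HermitianI)
    fix x y
    have "(\<lambda>k. (X k *v x) \<bullet> y) \<longlonglongrightarrow> (L *v x) \<bullet> y" "(\<lambda>k. x \<bullet> (X k *v y)) \<longlonglongrightarrow> x \<bullet> (L *v y)"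
      by (intro tendsto_intros lim)+
    then show "(L *v x) \<bullet> y = x \<bullet> (L *v y)"
      using LIMSEQ_unique by (simp add: Hermitian_inner[OF herm])
  qed
  moreover have "0 \<le> v \<bullet> (L *v v)" for v
  proof (rule LIMSEQ_le_const)
    show "(\<lambda>k. v \<bullet> (X k *v v)) \<longlonglongrightarrow> v \<bullet> (L *v v)"
      by (intro tendsto_intros lim)
  qed (use nonneg in auto)
  ultimately show ?thesis
    using that by (auto simp: nonneg_Hermitian_def)
qed

lemma riccati_solution:
  assumes "stabilizable A B"
  shows "nonneg_Hermitian (riccati_solution A B)" "riccati_equation A B (riccati_solution A B)"
proof -
  have "\<exists>!X. nonneg_Hermitian X \<and> riccati_equation A B X"
    using riccati_exists[OF assms] riccati_unique[of _ A B] by metis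
  then show "nonneg_Hermitian (riccati_solution A B)"
    "riccati_equation A B (riccati_solution A B)"
    unfolding riccati_solution_def by (metis (mono_tags, lifting) theI')+
qed

subsection \<open>Rayleigh quotients\<close>

lemma nonneg_Hermitian_kernel:
  assumes "nonneg_Hermitian X" and zero: "w \<bullet> (X *v w) = 0"
  shows "X *v w = 0"
proof (rule ccontr)
  assume nz: "X *v w \<noteq> 0"
  have X: "conj_transpose X = X" and nonneg: "\<And>v. 0 \<le> v \<bullet> (X *v v)"
    using assms(1) by (auto simp: nonneg_Hermitian_def)
  define z where "z = X *v w"
  define a where "a = z \<bullet> z"
  define b where "b = z \<bullet> (X *v z)"
  define t where "t = a / (b + 1)"
  have "a > 0" "b \<ge> 0"
    using nz nonneg[of z] by (simp_all add: a_def b_def z_def)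
  then have t: "t > 0" "a = t * (b + 1)"
    by (simp_all add: t_def)
  have "w \<bullet> (X *v z) = a"
    by (simp add: a_def z_def Hermitian_inner[OF X])
  moreover have "z \<bullet> (X *v w) = a"
    by (simp add: a_def z_def)
  ultimately have "(w - t *\<^sub>R z) \<bullet> (X *v (w - t *\<^sub>R z)) = - 2 * t * a + t * t * b"
    using zero by (simp add: matrix_vec_simps inner_diff_left inner_diff_right b_def
        algebra_simps)
  also have "\<dots> = - (t * t * (b + 2))"
    unfolding t(2) by (simp add: algebra_simps)
  also have "\<dots> < 0"
    using t(1) \<open>b \<ge> 0\<close> by simp
  finally show False
    using nonneg[of "w - t *\<^sub>R z"] by simp
qed

lemma bounded_linear_matrix: "bounded_linear ((*v) (M :: complex ^ 'm ^ 'n))"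
  using linear_matrix linear_conv_bounded_linear by blast

lemma rayleigh_min:
  fixes G :: "complex ^ 'n ^ 'n"
  assumes G: "conj_transpose G = G"
  obtains \<mu> where "complex_of_real \<mu> \<in> eigenvalues G" "\<And>v. \<mu> * (norm v)\<^sup>2 \<le> v \<bullet> (G *v v)"
proof -
  have "norm (axis undefined 1 :: complex ^ 'n) = 1"
    by (simp add: norm_eq_1 inner_axis_axis inner_complex_def)
  then have "(axis undefined 1 :: complex ^ 'n) \<in> sphere 0 1"
    by (simp only: mem_sphere_0)
  then have "sphere (0 :: complex ^ 'n) 1 \<noteq> {}"
    by blast
  moreover have "continuous_on (sphere 0 1) (\<lambda>v. v \<bullet> (G *v v))"
    by (rule continuous_on_inner[OF continuous_on_id linear_continuous_on[OF bounded_linear_matrix]])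
  ultimately obtain w where w: "w \<in> sphere 0 1"
    and min: "\<And>v. v \<in> sphere 0 1 \<Longrightarrow> w \<bullet> (G *v w) \<le> v \<bullet> (G *v v)"
    using continuous_attains_inf[OF compact_sphere, of 0 1 "\<lambda>v. v \<bullet> (G *v v)"] by blast
  define \<mu> where "\<mu> = w \<bullet> (G *v w)"
  have le: "\<mu> * (norm v)\<^sup>2 \<le> v \<bullet> (G *v v)" for v
  proof (cases "v = 0")
    case False
    define u where "u = (1 / norm v) *\<^sub>R v"
    have v: "v = norm v *\<^sub>R u" and "u \<in> sphere 0 1"
      using False by (simp_all add: u_def)
    have "v \<bullet> (G *v v) = (norm v)\<^sup>2 * (u \<bullet> (G *v u))"
      by (subst (1 2) v) (simp add: matrix_vec_simps power2_eq_square)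
    then show ?thesis
      using min[OF \<open>u \<in> sphere 0 1\<close>] by (simp add: \<mu>_def mult.commute mult_right_mono)
  qed simp
  define H where "H = G - \<mu> *\<^sub>R mat 1"
  have H: "H *v v = G *v v - \<mu> *\<^sub>R v" for v
    by (simp add: H_def matrix_vec_simps)
  have "nonneg_Hermitian H"
    using le by (simp add: nonneg_Hermitian_def H_def conj_transpose_diff conj_transpose_scaleR G
        H[unfolded H_def] inner_diff_right power2_norm_eq_inner)
  moreover have "w \<bullet> w = 1"
    using w by (simp add: norm_eq_1)
  then have "w \<bullet> (H *v w) = 0"
    by (simp add: H inner_diff_right \<mu>_def)
  ultimately have "H *v w = 0"
    by (rule nonneg_Hermitian_kernel)
  then have "G *v w = complex_of_real \<mu> *s w"
    by (simp add: H smult_of_real)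
  moreover have "w \<noteq> 0"
    using w by auto
  ultimately have "complex_of_real \<mu> \<in> eigenvalues G"
    by (auto simp: eigenvalues_def)
  then show ?thesis
    using that le by blast
qed

lemma norm_smult: "norm (c *s (x :: complex ^ 'n)) = cmod c * norm x"
proof -
  have "(norm (c *s x))\<^sup>2 = (cmod c * norm x)\<^sup>2"
    by (simp add: norm_vec_def L2_set_def norm_mult power_mult_distrib sum_nonneg
        flip: sum_distrib_left)
  then show ?thesis
    by (simp add: power2_eq_iff_nonneg)
qed

lemma numerical_radius_bound:
  fixes H :: "complex ^ 'n ^ 'n"
  assumes H: "conj_transpose H = H" and bd: "\<And>v. \<bar>v \<bullet> (H *v v)\<bar> \<le> r * (norm v)\<^sup>2"
  shows "norm (H *v z) \<le> r * norm z"
proof -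
  have unit: "x \<bullet> (H *v z) \<le> r" if "norm x = 1" "norm z = 1" for x z
  proof -
    have "x \<bullet> (H *v z) \<le> (r * (norm (x + z))\<^sup>2 + r * (norm (x - z))\<^sup>2) / 4"
      unfolding Hermitian_polarization[OF H, of x z] using bd[of "x + z"] bd[of "x - z"] by simp
    also have "\<dots> = r * ((norm (x + z))\<^sup>2 + (norm (x - z))\<^sup>2) / 4"
      by (simp only: distrib_left)
    also have "(norm (x + z))\<^sup>2 + (norm (x - z))\<^sup>2 = 2 * (norm x)\<^sup>2 + 2 * (norm z)\<^sup>2"
      by (simp add: power2_norm_eq_inner inner_add_left inner_add_right inner_diff_left
          inner_diff_right)
    also have "r * (2 * (norm x)\<^sup>2 + 2 * (norm z)\<^sup>2) / 4 = r"
      by (simp add: that)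
    finally show ?thesis .
  qed
  show ?thesis
  proof (cases "z = 0 \<or> H *v z = 0")
    case True
    have "0 \<le> r * (norm z)\<^sup>2"
      using bd[of z] by linarith
    then have "0 \<le> r * norm z"
      by (cases "z = 0") (auto simp: zero_le_mult_iff)
    then show ?thesis
      using True by auto
  next
    case False
    define x where "x = H *v z"
    have "((1 / norm x) *\<^sub>R x) \<bullet> (H *v ((1 / norm z) *\<^sub>R z)) \<le> r"
      using False by (intro unit) (simp_all add: x_def)
    then have "(x \<bullet> x) / (norm x * norm z) \<le> r"
      by (simp add: matrix_vec_simps mult.commute flip: x_def)
    moreover have "x \<bullet> x = norm x * norm x"
      by (simp add: power2_norm_eq_inner[symmetric] power2_eq_square)
    ultimately show ?thesis
      using False by (simp add: x_def field_simps)
  qed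
qed

lemma skew_Hermitian_near_scalar:
  fixes A :: "complex ^ 'n ^ 'n"
  assumes A: "skew_Hermitian A"
  obtains c where "\<And>z. norm (A *v z - (\<i> * complex_of_real c) *s z) \<le> spectral_spread A / 2 * norm z"
proof -
  define T where "T = (\<chi> i j. - \<i> * A $ i $ j)"
  have T: "T *v v = (- \<i>) *s (A *v v)" for v
    by (simp add: T_def vec_eq_iff matrix_vector_mult_def sum_distrib_left mult.assoc sum_negf)
  have hT: "conj_transpose T = T"
  proof (rule HermitianI)
    fix x y
    show "(T *v x) \<bullet> y = x \<bullet> (T *v y)"
      using A unfolding T inner_smult_left inner_matrix_left skew_Hermitian_def
      by (simp add: matrix_vec_simps matrix_vec_smult)
  qed
  have eig: "\<i> * complex_of_real l \<in> eigenvalues A" if l: "complex_of_real l \<in> eigenvalues T" for l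
  proof -
    obtain v where v: "v \<noteq> 0" "T *v v = complex_of_real l *s v"
      using l by (auto simp: eigenvalues_def)
    have "A *v v = \<i> *s (T *v v)"
      by (simp add: T)
    then show ?thesis
      using v by (auto simp: eigenvalues_def)
  qed
  obtain l where l: "complex_of_real l \<in> eigenvalues T" "\<And>v. l * (norm v)\<^sup>2 \<le> v \<bullet> (T *v v)"
    using rayleigh_min[OF hT] by blast
  have "conj_transpose (- T) = - T"
    by (simp add: conj_transpose_minus hT)
  then obtain k where k: "complex_of_real k \<in> eigenvalues (- T)"
      "\<And>v. k * (norm v)\<^sup>2 \<le> v \<bullet> (- T *v v)"
    using rayleigh_min by blast
  have "complex_of_real (- k) \<in> eigenvalues T"
  proof -
    obtain v where v: "v \<noteq> 0" "- T *v v = complex_of_real k *s v"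
      using k(1) by (auto simp: eigenvalues_def)
    have "T *v v = - (- T *v v)"
      by (simp add: matrix_minus_vec)
    also have "\<dots> = complex_of_real (- k) *s v"
      unfolding v(2) by (simp add: vec.scale_minus_left)
    finally show ?thesis
      using v(1) unfolding eigenvalues_def by blast
  qed
  define S where "S = {\<bar>l - k\<bar> | l k. \<i> * complex_of_real l \<in> eigenvalues A
                                         \<and> \<i> * complex_of_real k \<in> eigenvalues A}"
  have "S \<subseteq> (\<lambda>(x, y). \<bar>x - y\<bar>) ` (Im ` eigenvalues A \<times> Im ` eigenvalues A)"
    by (force simp: S_def image_iff)
  then have "finite S"
    by (rule finite_subset) (simp add: finite_eigenvalues)
  moreover have "\<bar>l - - k\<bar> \<in> S"
    unfolding S_def using eig l(1) \<open>complex_of_real (- k) \<in> eigenvalues T\<close> by blast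
  ultimately have "\<bar>l - - k\<bar> \<le> spectral_spread A"
    unfolding spectral_spread_def S_def[symmetric] by (rule Max_ge)
  then have spread: "- k - l \<le> spectral_spread A"
    by linarith
  define c where "c = (l - k) / 2"
  define H where "H = T - c *\<^sub>R mat 1"
  have H: "H *v v = T *v v - c *\<^sub>R v" for v
    by (simp add: H_def matrix_vec_simps)
  have bound: "norm (H *v z) \<le> spectral_spread A / 2 * norm z" for z
  proof (rule numerical_radius_bound)
    show "conj_transpose H = H"
      by (simp add: H_def conj_transpose_diff conj_transpose_scaleR hT)
    fix v :: "complex ^ 'n"
    have "(- k - l) / 2 * (norm v)\<^sup>2 \<le> spectral_spread A / 2 * (norm v)\<^sup>2"
      using spread by (intro mult_right_mono) auto
    moreover have "v \<bullet> (H *v v) = v \<bullet> (T *v v) - (l - k) / 2 * (norm v)\<^sup>2"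
      by (simp add: H inner_diff_right power2_norm_eq_inner c_def)
    ultimately show "\<bar>v \<bullet> (H *v v)\<bar> \<le> spectral_spread A / 2 * (norm v)\<^sup>2"
      using l(2)[of v] k(2)[of v] by (simp add: matrix_minus_vec field_simps abs_le_iff)
  qed
  have "A *v z - (\<i> * complex_of_real c) *s z = \<i> *s (H *v z)" for z
    by (simp add: H T vec.scale_right_diff_distrib smult_of_real[symmetric])
  then show ?thesis
    using bound by (intro that[of c]) (simp add: norm_smult)
qed

lemma skew_Hermitian_inner:
  assumes "skew_Hermitian A"
  shows "x \<bullet> (A *v y) = - ((A *v x) \<bullet> y)"
  using assms unfolding skew_Hermitian_def inner_matrix_left by (simp add: matrix_minus_vec)

lemma singular_values_finite_nonempty:
  fixes B :: "complex ^ 'm ^ 'n"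
  shows "finite (singular_values B)"
    and "\<exists>s\<in>singular_values B. \<forall>u. s * norm u \<le> norm (B *v u)"
proof -
  let ?G = "conj_transpose B ** B"
  have "s \<in> (\<lambda>\<nu>. sqrt (Re \<nu>)) ` eigenvalues ?G" if "s \<in> singular_values B" for s
    using that by (intro image_eqI[of _ _ "complex_of_real (s\<^sup>2)"]) (auto simp: singular_values_def)
  then have "singular_values B \<subseteq> (\<lambda>\<nu>. sqrt (Re \<nu>)) ` eigenvalues ?G"
    by blast
  then show "finite (singular_values B)"
    by (rule finite_subset) (simp add: finite_eigenvalues)
  have "conj_transpose ?G = ?G"
    by (simp add: conj_transpose_mult)
  then obtain \<mu> where \<mu>: "complex_of_real \<mu> \<in> eigenvalues ?G"
      "\<And>v. \<mu> * (norm v)\<^sup>2 \<le> v \<bullet> (?G *v v)"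
    using rayleigh_min by blast
  have G: "v \<bullet> (?G *v v) = (norm (B *v v))\<^sup>2" for v
    by (simp add: power2_norm_eq_inner inner_matrix_left flip: matrix_vector_mul_assoc)
  obtain w where w: "w \<noteq> 0" "?G *v w = complex_of_real \<mu> *s w"
    using \<mu>(1) by (auto simp: eigenvalues_def)
  have "\<mu> * (norm w)\<^sup>2 = (norm (B *v w))\<^sup>2"
    unfolding G[symmetric] w(2) by (simp add: smult_of_real power2_norm_eq_inner)
  then have "0 \<le> \<mu> * (norm w)\<^sup>2"
    by simp
  then have "\<mu> \<ge> 0"
    using w(1) by (simp add: zero_le_mult_iff)
  have "sqrt \<mu> * norm u \<le> norm (B *v u)" for u
  proof (rule power2_le_imp_le)
    show "(sqrt \<mu> * norm u)\<^sup>2 \<le> (norm (B *v u))\<^sup>2"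
      using \<mu>(2)[of u] \<open>\<mu> \<ge> 0\<close> by (simp add: G power_mult_distrib)
  qed simp
  moreover have "sqrt \<mu> \<in> singular_values B"
    using \<mu>(1) \<open>\<mu> \<ge> 0\<close> by (simp add: singular_values_def flip: of_real_power)
  ultimately show "\<exists>s\<in>singular_values B. \<forall>u. s * norm u \<le> norm (B *v u)"
    by blast
qed

lemma smallest_singular_value_in: "smallest_singular_value B \<in> singular_values B"
  unfolding smallest_singular_value_def
  using singular_values_finite_nonempty[of B] by (intro Min_in) auto

lemma smallest_singular_value_lower: "smallest_singular_value B * norm u \<le> norm (B *v u)"
proof -
  obtain s where "s \<in> singular_values B" "s * norm u \<le> norm (B *v u)"
    using singular_values_finite_nonempty(2) by blast
  moreover from this have "smallest_singular_value B \<le> s"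
    unfolding smallest_singular_value_def by (intro Min_le singular_values_finite_nonempty)
  ultimately show ?thesis
    by (meson mult_right_mono norm_ge_zero order_trans)
qed

lemma smallest_singular_value_range:
  fixes B :: "complex ^ 'm ^ 'n"
  shows "smallest_singular_value B * norm (B *v u) \<le> norm (conj_transpose B *v (B *v u))"
proof (cases "B *v u = 0")
  case False
  let ?s = "smallest_singular_value B" and ?z = "conj_transpose B *v (B *v u)"
  have "?s \<ge> 0"
    using smallest_singular_value_in[of B] by (simp add: singular_values_def)
  have "norm (B *v u) * norm (B *v u) = u \<bullet> ?z"
    by (simp add: inner_matrix_left[symmetric] power2_norm_eq_inner[symmetric] power2_eq_square)
  also have "\<dots> \<le> norm u * norm ?z"
    by (rule norm_cauchy_schwarz)
  finally have "?s * (norm (B *v u) * norm (B *v u)) \<le> ?s * (norm u * norm ?z)"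
    using \<open>?s \<ge> 0\<close> by (rule mult_left_mono)
  also have "\<dots> \<le> norm (B *v u) * norm ?z"
    using mult_right_mono[OF smallest_singular_value_lower[of B u], of "norm ?z"]
    by (simp only: mult.assoc norm_ge_zero)
  finally show ?thesis
    using False by (simp add: mult.left_commute)
qed simp

lemma norm_matrix_vec_le: "norm (B *v u) \<le> matrix_norm B * norm (u :: complex ^ 'm)"
  unfolding matrix_norm_def by (rule onorm) (rule bounded_linear_matrix)

lemma norm_conj_transpose_vec_le:
  fixes B :: "complex ^ 'm ^ 'n"
  shows "norm (conj_transpose B *v x) \<le> matrix_norm B * norm x"
proof (cases "conj_transpose B *v x = 0")
  case True
  have "0 \<le> matrix_norm B"
    unfolding matrix_norm_def by (rule onorm_pos_le) (rule bounded_linear_matrix)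
  then show ?thesis
    using True by simp
next
  case False
  let ?z = "conj_transpose B *v x"
  have "norm ?z * norm ?z = (B *v ?z) \<bullet> x"
    by (simp add: inner_matrix_left power2_norm_eq_inner[symmetric] power2_eq_square)
  also have "\<dots> \<le> norm (B *v ?z) * norm x"
    by (rule norm_cauchy_schwarz)
  also have "\<dots> \<le> matrix_norm B * norm ?z * norm x"
    by (intro mult_right_mono norm_matrix_vec_le) simp
  finally show ?thesis
    using False by (simp add: mult.left_commute mult.commute)
qed

lemma matrix_norm_single_input:
  fixes B :: "complex ^ 'm ^ 'n"
  assumes "CARD('m) = 1"
  shows "matrix_norm B \<le> smallest_singular_value B"
proof -
  let ?s = "smallest_singular_value B"
  have s: "?s \<ge> 0" "complex_of_real (?s\<^sup>2) \<in> eigenvalues (conj_transpose B ** B)"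
    using smallest_singular_value_in[of B] by (simp_all add: singular_values_def)
  then obtain w where w: "w \<noteq> 0" "conj_transpose B *v (B *v w) = complex_of_real (?s\<^sup>2) *s w"
    by (auto simp: eigenvalues_def matrix_vector_mul_assoc)
  have "(norm (B *v w))\<^sup>2 = w \<bullet> (conj_transpose B *v (B *v w))"
    by (simp add: power2_norm_eq_inner inner_matrix_left)
  also have "\<dots> = (?s * norm w)\<^sup>2"
    unfolding w(2) smult_of_real by (simp add: power_mult_distrib power2_norm_eq_inner)
  finally have Bw: "norm (B *v w) = ?s * norm w"
    using s(1) by (simp add: power2_eq_iff_nonneg)
  obtain i :: 'm where i: "UNIV = {i}"
    using assms card_1_singletonE by blast
  have "w $ i \<noteq> 0"
    using w(1) i by (auto simp: vec_eq_iff)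
  show ?thesis
    unfolding matrix_norm_def
  proof (rule onorm_bound[OF s(1)])
    fix u
    have "u $ j = (u $ i / w $ i) * w $ j" for j
    proof -
      have "j = i"
        using i by (metis UNIV_I singletonD)
      then show ?thesis
        using \<open>w $ i \<noteq> 0\<close> by simp
    qed
    then have u: "u = (u $ i / w $ i) *s w"
      unfolding vec_eq_iff vector_smult_component by blast
    show "norm (B *v u) \<le> ?s * norm u"
      by (subst (1 2) u) (simp add: matrix_vec_smult norm_smult Bw)
  qed
qed

subsection \<open>Decay of the closed loop\<close>

lemma closed_loop_apply:
  "closed_loop A B *v v
    = A *v v - B *v (conj_transpose B *v (riccati_solution A B *v v))"
  unfolding closed_loop_def feedback_gain_def by (rule closed_loop_vec)

lemma closed_loop_stable:
  assumes "stabilizable A B"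
  shows "stable_matrix (closed_loop A B)"
  unfolding closed_loop_def feedback_gain_def
  using riccati_solution[OF assms] by (rule riccati_stable)

lemma decay_rate_attained: "\<exists>\<nu>\<in>eigenvalues (closed_loop A B). decay_rate A B = \<bar>Re \<nu>\<bar>"
proof -
  have "decay_rate A B \<in> (\<lambda>\<nu>. \<bar>Re \<nu>\<bar>) ` eigenvalues (closed_loop A B)"
    unfolding decay_rate_def
    by (rule Min_in) (simp_all add: finite_eigenvalues eigenvalues_nonempty)
  then show ?thesis
    by blast
qed

lemma decay_rate_le: "\<nu> \<in> eigenvalues (closed_loop A B) \<Longrightarrow> decay_rate A B \<le> \<bar>Re \<nu>\<bar>"
  unfolding decay_rate_def by (rule Min_le) (simp_all add: finite_eigenvalues)

lemma decay_rate_le_matrix_norm: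
  fixes A :: "complex ^ 'n ^ 'n" and B :: "complex ^ 'm ^ 'n"
  assumes A: "skew_Hermitian A" and AB: "stabilizable A B"
  shows "decay_rate A B \<le> matrix_norm B"
proof -
  define X where "X = riccati_solution A B"
  obtain \<nu> where \<nu>: "\<nu> \<in> eigenvalues (closed_loop A B)" and decay: "decay_rate A B = \<bar>Re \<nu>\<bar>"
    using decay_rate_attained by blast
  have "Re \<nu> < 0"
    using closed_loop_stable[OF AB] \<nu> by (simp add: stable_matrix_def)
  define a where "a = - Re \<nu>"
  have "a > 0" "decay_rate A B = a"
    using \<open>Re \<nu> < 0\<close> decay by (simp_all add: a_def)
  obtain v where v: "v \<noteq> 0" "closed_loop A B *v v = \<nu> *s v"
    using \<nu> by (auto simp: eigenvalues_def)
  define y where "y = X *v v"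
  have av: "A *v v - \<nu> *s v = B *v (conj_transpose B *v y)"
    using v(2) by (simp add: closed_loop_apply X_def y_def algebra_simps)
  have "X *v (B *v (conj_transpose B *v y)) - X *v (A *v v) + A *v y - v = 0"
    using riccati_solution(2)[OF AB] A
    by (simp add: riccati_equation_iff X_def y_def skew_Hermitian_def matrix_minus_vec)
  moreover have "X *v (B *v (conj_transpose B *v y)) = X *v (A *v v) - \<nu> *s y"
    unfolding av[symmetric] by (simp add: matrix_vec_simps matrix_vec_smult y_def)
  ultimately have ay: "A *v y - \<nu> *s y = v"
    by (simp add: algebra_simps)
  have expand: "a * norm z \<le> norm (A *v z - \<nu> *s z)" for z
  proof (cases "z = 0")
    case False
    have "z \<bullet> (A *v z) = 0"
      using skew_Hermitian_inner[OF A, of z z] by (simp add: inner_commute)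
    moreover have "z \<bullet> (\<nu> *s z) = Re \<nu> * (z \<bullet> z)"
      using inner_smult_Hermitian[OF conj_transpose_mat_1, of z \<nu>] by simp
    ultimately have "a * (norm z * norm z) = z \<bullet> (A *v z - \<nu> *s z)"
      by (simp add: inner_diff_right a_def power2_norm_eq_inner[symmetric] power2_eq_square)
    also have "\<dots> \<le> norm z * norm (A *v z - \<nu> *s z)"
      by (rule norm_cauchy_schwarz)
    finally show ?thesis
      using False by (simp add: mult.left_commute)
  qed simp
  have nonneg: "0 \<le> matrix_norm B"
    unfolding matrix_norm_def by (rule onorm_pos_le[OF bounded_linear_matrix])
  have "y \<noteq> 0"
    using v(1) ay by auto
  have "a * (a * norm y) \<le> a * norm v"
    using expand[of y] \<open>a > 0\<close> by (simp add: ay)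
  also have "\<dots> \<le> norm (B *v (conj_transpose B *v y))"
    using expand[of v] by (simp add: av)
  also have "\<dots> \<le> matrix_norm B * norm (conj_transpose B *v y)"
    by (rule norm_matrix_vec_le)
  also have "\<dots> \<le> matrix_norm B * (matrix_norm B * norm y)"
    by (intro mult_left_mono norm_conj_transpose_vec_le nonneg)
  finally have "a\<^sup>2 * norm y \<le> (matrix_norm B)\<^sup>2 * norm y"
    by (simp add: power2_eq_square mult.assoc)
  then have "a\<^sup>2 \<le> (matrix_norm B)\<^sup>2"
    using \<open>y \<noteq> 0\<close> by simp
  then have "a \<le> matrix_norm B"
    using nonneg by (rule power2_le_imp_le)
  then show ?thesis
    by (simp add: \<open>decay_rate A B = a\<close>)
qed

lemma wide_matrix_kernel:
  fixes F :: "complex ^ 'n ^ 'm"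
  assumes "CARD('m) < CARD('n)"
  obtains v where "v \<noteq> 0" "F *v v = 0"
proof (rule ccontr)
  assume "\<not> thesis"
  then have "inj ((*v) F)"
    using that linear_matrix[of F] by (auto simp: linear_injective_0)
  then have "dim (range ((*v) F)) = DIM(complex ^ 'n)"
    using dim_image_eq[OF linear_matrix, of F UNIV] by (simp add: dim_UNIV)
  moreover have "dim (range ((*v) F)) \<le> DIM(complex ^ 'm)"
    by (rule dim_subset_UNIV)
  ultimately show False
    using assms by simp
qed

lemma kernel_projection:
  fixes B :: "complex ^ 'm ^ 'n"
  assumes inj: "\<And>u. B *v u = 0 \<Longrightarrow> u = 0"
  obtains P where "conj_transpose P = P" "\<And>x. conj_transpose B *v (P *v x) = 0"
    "\<And>x. conj_transpose B *v x = 0 \<Longrightarrow> P *v x = x" "\<And>x. x - P *v x \<in> range ((*v) B)"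
proof -
  define G where "G = conj_transpose B ** B"
  have hG: "conj_transpose G = G"
    by (simp add: G_def conj_transpose_mult)
  have "u = 0" if "G *v u = 0" for u
  proof -
    have "(B *v u) \<bullet> (B *v u) = u \<bullet> (G *v u)"
      by (simp add: G_def inner_matrix_left flip: matrix_vector_mul_assoc)
    then show ?thesis
      using that inj by simp
  qed
  then have "inj ((*v) G)"
    by (simp add: linear_injective_0[OF linear_matrix])
  then obtain N where "N ** G = mat 1"
    unfolding matrix_left_invertible_injective[symmetric] by blast
  then have GN: "G ** N = mat 1"
    by (simp add: matrix_left_right_inverse)
  have "conj_transpose N = (N ** G) ** conj_transpose N"
    by (simp add: \<open>N ** G = mat 1\<close> matrix_mul_lid)
  also have "\<dots> = N ** conj_transpose (N ** G)"
    by (simp add: conj_transpose_mult hG matrix_mul_assoc)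
  also have "\<dots> = N"
    by (simp add: \<open>N ** G = mat 1\<close> matrix_mul_rid)
  finally have hN: "conj_transpose N = N" .
  define P where "P = mat 1 - B ** N ** conj_transpose B"
  have P: "P *v x = x - B *v (N *v (conj_transpose B *v x))" for x
    by (simp add: P_def matrix_vec_simps flip: matrix_vector_mul_assoc)
  show ?thesis
  proof (rule that[of P])
    show "conj_transpose P = P"
      by (simp add: P_def conj_transpose_diff conj_transpose_mult hN matrix_mul_assoc)
    fix x
    have "conj_transpose B *v (B *v (N *v z)) = z" for z
      using GN by (metis G_def matrix_vector_mul_assoc matrix_vector_mul_lid)
    then show "conj_transpose B *v (P *v x) = 0"
      by (simp add: P matrix_vec_simps)
    show "P *v x = x" if "conj_transpose B *v x = 0"
      using that by (simp add: P)
    show "x - P *v x \<in> range ((*v) B)"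
      by (simp add: P)
  qed
qed

text \<open>The Cauchy-Schwarz lower bound for \<open>- 2 (W v) \<bullet> (K v + \<surd>3 D v) / D\<close>, where \<open>p\<close>, \<open>r\<close> are
  the norms of the components of \<open>v\<close> in \<open>range B\<close> and \<open>ker B\<^sup>*\<close>, and \<open>q\<close>, \<open>s\<close> those of
  \<open>D X v\<close>.  Scaling \<open>q\<close> and \<open>s\<close> by \<open>\<surd>3\<close> makes the coefficients nearly rational.\<close>

lemma dissipation_form_positive:
  fixes p q r s :: real
  assumes nz: "p \<noteq> 0 \<or> r \<noteq> 0" and "0 \<le> q" "0 \<le> s"
  shows "0 < p\<^sup>2 + r\<^sup>2 + 8 * q\<^sup>2 - 2 * sqrt 3 * (p * q) - 4 * sqrt 3 * (r * s) + 2 * sqrt 3 * r\<^sup>2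
    + 6 * s\<^sup>2 - r * p - sqrt 3 * (s * q)" (is "0 < ?E")
proof -
  define t :: real where "t = sqrt 3"
  have "1.7 \<le> sqrt (3 :: real)"
    by (rule real_le_rsqrt) (simp add: power2_eq_square)
  moreover have "sqrt (3 :: real) \<le> 1.8"
    by (rule real_le_lsqrt) (simp_all add: power2_eq_square)
  ultimately have t: "t * t = 3" "1.7 \<le> t" "t \<le> 1.8"
    by (simp_all add: t_def)
  define q' where "q' = t * q"
  define s' where "s' = t * s"
  have nn: "0 \<le> q'" "0 \<le> s'"
    using assms t by (simp_all add: q'_def s'_def)
  have q2: "q'\<^sup>2 = 3 * q\<^sup>2" and s2: "s'\<^sup>2 = 3 * s\<^sup>2" and qs: "s' * q' = 3 * (s * q)"
    using t(1) by (simp_all add: q'_def s'_def power2_eq_square mult_ac)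
  have 1: "2 * t * r\<^sup>2 \<ge> 3.4 * r\<^sup>2"
    using t by (intro mult_right_mono) auto
  have "t * (s' * q') \<le> 1.8 * (s' * q')"
    using t nn by (intro mult_right_mono) auto
  then have 2: "t * (s * q) \<le> 0.6 * (s' * q')"
    unfolding qs by (simp add: mult_ac)
  have "?E = p\<^sup>2 + r\<^sup>2 + 8 / 3 * q'\<^sup>2 - 2 * (p * q') - 4 * (r * s') + 2 * t * r\<^sup>2 + 2 * s'\<^sup>2
      - r * p - t * (s * q)"
    unfolding q2 s2 by (simp add: t_def[symmetric] q'_def s'_def algebra_simps)
  also have "\<dots> \<ge> p\<^sup>2 + 4.4 * r\<^sup>2 + 8 / 3 * q'\<^sup>2 - 2 * (p * q') - 4 * (r * s') + 2 * s'\<^sup>2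
      - r * p - 0.6 * (s' * q')" (is "_ \<ge> ?R")
    using 1 2 by simp
  finally have "?R \<le> ?E" .
  moreover have "?R = (p - q' - r / 2)\<^sup>2 + 2 * (s' - r - 0.15 * q')\<^sup>2 + (q' - 0.8 * r)\<^sup>2
      + (2 / 3 - 0.045) * q'\<^sup>2 + 1.51 * r\<^sup>2"
    by (simp add: power2_eq_square field_simps)
  moreover have "0 < \<dots>"
  proof (cases "r = 0 \<and> q' = 0")
    case True
    then have "0 < (p - q' - r / 2)\<^sup>2"
      using nz by simp
    then show ?thesis
      by (intro add_pos_nonneg) auto
  next
    case False
    then have "0 < (2 / 3 - 0.045) * q'\<^sup>2 + 1.51 * r\<^sup>2"
      by (cases "r = 0") (auto intro: add_nonneg_pos)
    then show ?thesis
      by (smt (verit) zero_le_power2)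
  qed
  ultimately show ?thesis
    by simp
qed

lemma skew_Hermitian_coupling:
  fixes A :: "complex ^ 'n ^ 'n" and B :: "complex ^ 'm ^ 'n"
  assumes A: "skew_Hermitian A" and x: "conj_transpose B *v x = 0" and z: "z \<in> range ((*v) B)"
  shows "\<bar>x \<bullet> (A *v z)\<bar> \<le> spectral_spread A / 2 * (norm x * norm z)"
proof -
  obtain c where c: "norm (A *v z - (\<i> * complex_of_real c) *s z) \<le> spectral_spread A / 2 * norm z"
    using skew_Hermitian_near_scalar[OF A] by blast
  obtain u where u: "z = B *v u"
    using z by blast
  have "x \<bullet> ((\<i> * complex_of_real c) *s z) = x \<bullet> (B *v ((\<i> * complex_of_real c) *s u))"
    by (simp add: u matrix_vec_smult)
  then have "x \<bullet> (A *v z) = x \<bullet> (A *v z - (\<i> * complex_of_real c) *s z)"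
    by (simp add: inner_diff_right inner_matrix_right x)
  then have "\<bar>x \<bullet> (A *v z)\<bar> \<le> norm x * norm (A *v z - (\<i> * complex_of_real c) *s z)"
    by (metis Cauchy_Schwarz_ineq2)
  also have "\<dots> \<le> norm x * (spectral_spread A / 2 * norm z)"
    using c by (rule mult_left_mono) simp
  finally show ?thesis
    by (simp add: mult_ac)
qed

lemma slow_closed_loop_eigenvalue:
  fixes A :: "complex ^ 'n ^ 'n" and B :: "complex ^ 'm ^ 'n"
  assumes A: "skew_Hermitian A" and inj: "\<And>u. B *v u = 0 \<Longrightarrow> u = 0" and AB: "stabilizable A B"
    and mn: "CARD('m) < CARD('n)"
    and sing: "smallest_singular_value B > 2 * sqrt 2 * spectral_spread A"
  shows "\<exists>\<nu>\<in>eigenvalues (closed_loop A B). - sqrt 3 * spectral_spread A < Re \<nu>"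
proof (rule ccontr)
  assume "\<not> ?thesis"
  then have fast: "Re \<nu> \<le> - sqrt 3 * spectral_spread A" if "\<nu> \<in> eigenvalues (closed_loop A B)" for \<nu>
    using that by force
  define X where "X = riccati_solution A B"
  have X: "conj_transpose X = X" and ric: "riccati_equation A B X"
    using riccati_solution[OF AB] by (simp_all add: X_def nonneg_Hermitian_def)
  define D where "D = spectral_spread A"
  define K where "K = closed_loop A B"
  have K: "K *v v = A *v v - B *v (conj_transpose B *v (X *v v))" for v
    by (simp add: K_def X_def closed_loop_apply)
  have diss: "2 * ((X *v v) \<bullet> (K *v v)) = - ((norm v)\<^sup>2 + (norm (conj_transpose B *v (X *v v)))\<^sup>2)" for v
    unfolding K by (rule riccati_dissipation[OF X ric])
  obtain v0 where v0: "v0 \<noteq> 0" "conj_transpose B *v (X *v v0) = 0"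
    using wide_matrix_kernel[OF mn, of "conj_transpose B ** X"]
    by (auto simp flip: matrix_vector_mul_assoc)
  obtain c where c: "\<And>z. norm (A *v z - (\<i> * complex_of_real c) *s z) \<le> D / 2 * norm z"
    using skew_Hermitian_near_scalar[OF A] by (auto simp: D_def)
  have "D \<ge> 0"
  proof -
    have "0 \<le> D / 2 * norm v0"
      using c[of v0] norm_ge_zero order_trans by blast
    then show ?thesis
      using v0(1) by (simp add: zero_le_mult_iff)
  qed
  moreover have "D \<noteq> 0"
  proof
    assume "D = 0"
    then have "A *v v0 = (\<i> * complex_of_real c) *s v0"
      using c[of v0] by simp
    then have "(X *v v0) \<bullet> (K *v v0) = v0 \<bullet> ((\<i> * complex_of_real c) *s (X *v v0))"
      by (simp add: K v0(2) Hermitian_inner[OF X] matrix_vec_smult)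
    then have "(X *v v0) \<bullet> (K *v v0) = 0"
      by (simp add: inner_smult_Hermitian[OF X])
    then show False
      using diss[of v0] v0 by simp
  qed
  ultimately have "D > 0"
    by simp
  obtain P where P: "conj_transpose P = P" and BP: "\<And>x. conj_transpose B *v (P *v x) = 0"
    and Pid: "\<And>x. conj_transpose B *v x = 0 \<Longrightarrow> P *v x = x"
    and range: "\<And>x. x - P *v x \<in> range ((*v) B)"
    using kernel_projection[OF inj] by blast
  have PA: "\<bar>(P *v x) \<bullet> (A *v (z - P *v z))\<bar> \<le> D / 2 * (norm (P *v x) * norm (z - P *v z))" for x z
    unfolding D_def by (rule skew_Hermitian_coupling[OF A BP range])
  have AA: "x \<bullet> (A *v x) = 0" for x
    using skew_Hermitian_inner[OF A, of x x] by (simp add: inner_commute)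
  have PP: "P *v (P *v x) = P *v x" for x
    by (rule Pid[OF BP])
  have orth: "(P *v x) \<bullet> z = (P *v x) \<bullet> (P *v z)" for x z
    by (metis Hermitian_inner[OF P] PP)
  have split: "(P *v x) \<bullet> (A *v z) = (P *v x) \<bullet> (A *v (z - P *v z)) + (P *v x) \<bullet> (A *v (P *v z))" for x z
    by (simp add: matrix_vec_simps inner_diff_right)
  define W where "W = D *\<^sub>R X - P - (sqrt 3 * D\<^sup>2) *\<^sub>R (X ** P ** X)"
  have W: "W *v v = D *\<^sub>R (X *v v) - P *v v - (sqrt 3 * D\<^sup>2) *\<^sub>R (X *v (P *v (X *v v)))" for v
    by (simp add: W_def matrix_vec_simps flip: matrix_vector_mul_assoc)
  have hW: "conj_transpose W = W"
    by (simp add: W_def conj_transpose_diff conj_transpose_scaleR conj_transpose_mult X P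
        matrix_mul_assoc)
  define M where "M = K + (sqrt 3 * D) *\<^sub>R mat 1"
  have M: "M *v v = K *v v + (sqrt 3 * D) *\<^sub>R v" for v
    by (simp add: M_def matrix_vec_simps)
  have neg: "(W *v v) \<bullet> (M *v v) < 0" if "v \<noteq> 0" for v
  proof -
    define y where "y = X *v v"
    define v1 v2 y1 y2 where "v1 = v - P *v v" and "v2 = P *v v" and "y1 = y - P *v y" and "y2 = P *v y"
    define p q r s where "p = norm v1" and "q = D * norm y1" and "r = norm v2" and "s = D * norm y2"
    have XK: "X *v (K *v v) = A *v y - v"
      using ric A unfolding riccati_equation_iff K y_def skew_Hermitian_def
      by (simp add: matrix_vec_simps algebra_simps)
    have cross: "x1 \<bullet> z2 = 0" if "x1 = x - P *v x" "z2 = P *v z" for x z x1 z2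
      using orth[of z x] unfolding that by (simp add: inner_diff_left) (simp add: inner_commute)
    have v12: "v1 \<bullet> v2 = 0" "v2 \<bullet> v1 = 0" and y12: "y1 \<bullet> y2 = 0" "y2 \<bullet> y1 = 0"
      and v1y2: "v1 \<bullet> y2 = 0" and y1v2: "y1 \<bullet> v2 = 0"
      using cross[OF v1_def v2_def] cross[OF y1_def y2_def] cross[OF v1_def y2_def]
        cross[OF y1_def v2_def] by (simp_all add: inner_commute)
    have v: "v = v1 + v2" and y: "y = y1 + y2"
      by (simp_all add: v1_def v2_def y1_def y2_def)
    have nv: "(norm v)\<^sup>2 = p\<^sup>2 + r\<^sup>2"
      unfolding p_def r_def power2_norm_eq_inner v by (simp add: inner_add_left inner_add_right v12)
    have By: "8 * q\<^sup>2 \<le> (norm (conj_transpose B *v y))\<^sup>2"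
    proof -
      obtain u where u: "y1 = B *v u"
        using range[of y] by (auto simp: y1_def)
      have "conj_transpose B *v y = conj_transpose B *v y1"
        by (simp add: y1_def matrix_vec_simps BP)
      moreover have "(2 * sqrt 2 * D) * norm y1 \<le> norm (conj_transpose B *v y1)"
        using mult_right_mono[OF less_imp_le[OF sing], of "norm y1"]
          smallest_singular_value_range[of B u] by (simp add: u D_def)
      ultimately have "((2 * sqrt 2 * D) * norm y1)\<^sup>2 \<le> (norm (conj_transpose B *v y))\<^sup>2"
        using \<open>D > 0\<close> by (intro power_mono) auto
      then show ?thesis
        by (simp add: q_def power_mult_distrib)
    qed
    define b where "b = norm (conj_transpose B *v y)"
    have "y \<bullet> v = y1 \<bullet> v1 + y2 \<bullet> v2"
      using cross[OF y1_def v2_def] cross[OF v1_def y2_def]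
      by (simp add: v y inner_add_left inner_add_right inner_commute)
    then have e1: "2 * (y \<bullet> (M *v v))
        = - (p\<^sup>2 + r\<^sup>2 + b\<^sup>2) + 2 * sqrt 3 * D * (y1 \<bullet> v1 + y2 \<bullet> v2)"
      using diss[of v] by (simp add: M inner_add_right b_def nv flip: y_def)
    have "v2 \<bullet> (K *v v) = v2 \<bullet> (A *v v1)"
      using split[of v v] AA[of v2] BP[of v]
      by (simp add: K inner_diff_right inner_matrix_right[of _ B] v1_def v2_def)
    moreover have "v2 \<bullet> v = r\<^sup>2"
      using orth[of v v] by (simp add: v2_def r_def power2_norm_eq_inner)
    ultimately have e2: "v2 \<bullet> (M *v v) = v2 \<bullet> (A *v v1) + sqrt 3 * D * r\<^sup>2"
      by (simp add: M inner_add_right)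
    have "(X *v y2) \<bullet> (M *v v) = y2 \<bullet> (A *v y) - y2 \<bullet> v + sqrt 3 * D * (y2 \<bullet> y)"
      by (simp add: M Hermitian_inner[OF X] matrix_vector_right_distrib XK inner_add_right
          inner_diff_right linear_cmul[OF linear_matrix] flip: y_def)
    moreover have "y2 \<bullet> (A *v y) = y2 \<bullet> (A *v y1)"
      using split[of y y] AA[of y2] by (simp add: y1_def y2_def)
    moreover have "y2 \<bullet> v = y2 \<bullet> v2" "y2 \<bullet> y = y2 \<bullet> y2"
      using orth[of y v] orth[of y y] by (simp_all add: y2_def v2_def)
    ultimately have e3: "(X *v y2) \<bullet> (M *v v)
        = y2 \<bullet> (A *v y1) - y2 \<bullet> v2 + sqrt 3 * D * (y2 \<bullet> y2)"
      by simp
    have s2: "s\<^sup>2 = D\<^sup>2 * (y2 \<bullet> y2)"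
      by (simp add: s_def power_mult_distrib power2_norm_eq_inner)
    have "(W *v v) \<bullet> (M *v v)
        = D * (y \<bullet> (M *v v)) - v2 \<bullet> (M *v v) - sqrt 3 * D\<^sup>2 * ((X *v y2) \<bullet> (M *v v))"
      by (simp add: W inner_diff_left y_def v2_def y2_def)
    then have "2 * ((W *v v) \<bullet> (M *v v)) = D * (2 * (y \<bullet> (M *v v))) - 2 * (v2 \<bullet> (M *v v))
        - 2 * sqrt 3 * D\<^sup>2 * ((X *v y2) \<bullet> (M *v v))"
      by (simp add: algebra_simps)
    also have "\<dots> = - D * (p\<^sup>2 + r\<^sup>2 + b\<^sup>2 - 2 * sqrt 3 * (D * (y1 \<bullet> v1)) - 4 * sqrt 3 * (D * (y2 \<bullet> v2))
        + 2 * sqrt 3 * r\<^sup>2 + 6 * s\<^sup>2) - 2 * (v2 \<bullet> (A *v v1)) - 2 * sqrt 3 * D\<^sup>2 * (y2 \<bullet> (A *v y1))"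
      unfolding e1 e2 e3 s2
      by (simp add: algebra_simps power2_eq_square)
    also have "\<dots> \<le> - D * (p\<^sup>2 + r\<^sup>2 + 8 * q\<^sup>2 - 2 * sqrt 3 * (p * q) - 4 * sqrt 3 * (r * s)
        + 2 * sqrt 3 * r\<^sup>2 + 6 * s\<^sup>2) + D * (r * p) + sqrt 3 * D * (s * q)"
    proof -
      have "D * (y1 \<bullet> v1) \<le> D * (norm y1 * norm v1)" "D * (y2 \<bullet> v2) \<le> D * (norm y2 * norm v2)"
        using \<open>D > 0\<close> by (simp_all add: norm_cauchy_schwarz)
      then have "D * (y1 \<bullet> v1) \<le> p * q" "D * (y2 \<bullet> v2) \<le> r * s"
        by (simp_all add: p_def q_def r_def s_def mult_ac)
      then have "2 * sqrt 3 * (D * (y1 \<bullet> v1)) \<le> 2 * sqrt 3 * (p * q)"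
        "4 * sqrt 3 * (D * (y2 \<bullet> v2)) \<le> 4 * sqrt 3 * (r * s)"
        by simp_all
      then have "D * (p\<^sup>2 + r\<^sup>2 + 8 * q\<^sup>2 - 2 * sqrt 3 * (p * q) - 4 * sqrt 3 * (r * s)
          + 2 * sqrt 3 * r\<^sup>2 + 6 * s\<^sup>2)
        \<le> D * (p\<^sup>2 + r\<^sup>2 + b\<^sup>2 - 2 * sqrt 3 * (D * (y1 \<bullet> v1)) - 4 * sqrt 3 * (D * (y2 \<bullet> v2))
          + 2 * sqrt 3 * r\<^sup>2 + 6 * s\<^sup>2)"
        using By \<open>D > 0\<close> unfolding b_def[symmetric] by (intro mult_left_mono) linarith+
      moreover have "- (2 * (v2 \<bullet> (A *v v1))) \<le> D * (r * p)"
        using PA[of v v] by (simp add: v2_def v1_def r_def p_def abs_le_iff)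
      moreover have "2 * sqrt 3 * D\<^sup>2 * (- (y2 \<bullet> (A *v y1))) \<le> 2 * sqrt 3 * D\<^sup>2 * (D / 2 * (norm y2 * norm y1))"
        using PA[of y y] by (intro mult_left_mono) (simp_all add: y2_def y1_def abs_le_iff)
      then have "- (2 * sqrt 3 * D\<^sup>2 * (y2 \<bullet> (A *v y1))) \<le> sqrt 3 * D * (s * q)"
        by (simp add: s_def q_def power2_eq_square mult_ac)
      ultimately show ?thesis
        by linarith
    qed
    also have "\<dots> = - D * (p\<^sup>2 + r\<^sup>2 + 8 * q\<^sup>2 - 2 * sqrt 3 * (p * q) - 4 * sqrt 3 * (r * s)
        + 2 * sqrt 3 * r\<^sup>2 + 6 * s\<^sup>2 - r * p - sqrt 3 * (s * q))"
      by (simp add: algebra_simps)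
    also have "\<dots> < 0"
    proof -
      have "p \<noteq> 0 \<or> r \<noteq> 0"
        using \<open>v \<noteq> 0\<close> v by (auto simp: p_def r_def)
      then have "0 < p\<^sup>2 + r\<^sup>2 + 8 * q\<^sup>2 - 2 * sqrt 3 * (p * q) - 4 * sqrt 3 * (r * s)
        + 2 * sqrt 3 * r\<^sup>2 + 6 * s\<^sup>2 - r * p - sqrt 3 * (s * q)"
        using \<open>D > 0\<close> by (intro dissipation_form_positive) (simp_all add: q_def s_def)
      then show ?thesis
        using \<open>D > 0\<close> by (simp only: mult_minus_left neg_less_0_iff_less mult_pos_pos)
    qed
    finally show ?thesis
      by simp
  qed
  have "v0 \<bullet> (W *v v0) > 0"
  proof (rule lyapunov_positive[OF hW _ neg v0(1)])
    fix \<nu> assume "\<nu> \<in> eigenvalues M"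
    then obtain v where v: "v \<noteq> 0" "M *v v = \<nu> *s v"
      by (auto simp: eigenvalues_def)
    have "K *v v = (\<nu> - complex_of_real (sqrt 3 * D)) *s v"
      using v(2) unfolding M vec.scale_left_diff_distrib smult_of_real by (simp add: algebra_simps)
    then have "\<nu> - complex_of_real (sqrt 3 * D) \<in> eigenvalues (closed_loop A B)"
      using v(1) unfolding eigenvalues_def K_def by blast
    then show "Re \<nu> \<le> 0"
      using fast by (fastforce simp: D_def)
  qed
  moreover have "v0 \<bullet> (W *v v0) \<le> 0"
  proof -
    define y where "y = X *v v0"
    have "P *v y = y"
      using v0(2) Pid by (simp add: y_def)
    define r s where "r = norm (P *v v0)" and "s = D * norm y"
    have "v0 \<bullet> (W *v v0) = D * (v0 \<bullet> y) - v0 \<bullet> (P *v v0) - sqrt 3 * D\<^sup>2 * (v0 \<bullet> (X *v y))"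
      unfolding W by (simp add: inner_diff_right \<open>P *v y = y\<close> flip: y_def)
    also have "v0 \<bullet> (X *v y) = y \<bullet> y"
      by (simp add: y_def Hermitian_inner[OF X])
    also have "v0 \<bullet> (P *v v0) = r\<^sup>2"
      using orth[of v0 v0] by (simp add: r_def power2_norm_eq_inner inner_commute)
    also have "v0 \<bullet> y = (P *v v0) \<bullet> y"
      by (metis \<open>P *v y = y\<close> Hermitian_inner[OF P])
    also have "D * ((P *v v0) \<bullet> y) \<le> r * s"
      using mult_left_mono[OF norm_cauchy_schwarz[of "P *v v0" y], of D] \<open>D > 0\<close>
      by (simp add: r_def s_def mult_ac)
    also have "sqrt 3 * D\<^sup>2 * (y \<bullet> y) = sqrt 3 * s\<^sup>2"
      by (simp add: s_def power2_norm_eq_inner power_mult_distrib)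
    finally have "v0 \<bullet> (W *v v0) \<le> r * s - r\<^sup>2 - sqrt 3 * s\<^sup>2"
      by simp
    moreover have "s\<^sup>2 \<le> sqrt 3 * s\<^sup>2"
      by (simp add: mult_le_cancel_right1)
    moreover have "r * s - r\<^sup>2 - s\<^sup>2 = - ((r - s)\<^sup>2 + r\<^sup>2 + s\<^sup>2) / 2"
      by (simp add: power2_eq_square field_simps)
    ultimately show ?thesis
      using zero_le_power2[of "r - s"] zero_le_power2[of r] zero_le_power2[of s] by argo
  qed
  ultimately show False
    by simp
qed

theorem corollary8:
  fixes A :: "complex ^ 'n ^ 'n" and B :: "complex ^ 'm ^ 'n"
  assumes "CARD('m) \<le> CARD('n)"
    and "skew_Hermitian A"
    and "{v. B *v v = 0} = {0}"
    and "stabilizable A B"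
  shows "decay_rate A B \<le> matrix_norm B
    \<and> (smallest_singular_value B > 2 * sqrt 2 * spectral_spread A \<and> CARD('m) < CARD('n)
         \<longrightarrow> decay_rate A B < sqrt 3 * spectral_spread A)
    \<and> (CARD('m) = 1 \<and> CARD('m) < CARD('n) \<and> controllable A B
         \<longrightarrow> decay_rate A B \<le> 2 * sqrt 2 * spectral_spread A)"
proof -
  have bound: "decay_rate A B \<le> matrix_norm B"
    using assms by (intro decay_rate_le_matrix_norm)
  have slow: "decay_rate A B < sqrt 3 * spectral_spread A"
    if gap: "smallest_singular_value B > 2 * sqrt 2 * spectral_spread A" "CARD('m) < CARD('n)"
  proof -
    have inj: "B *v u = 0 \<Longrightarrow> u = 0" for u
      using assms(3) by blast
    obtain \<nu> where \<nu>: "\<nu> \<in> eigenvalues (closed_loop A B)" "- sqrt 3 * spectral_spread A < Re \<nu>"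
      using slow_closed_loop_eigenvalue[OF assms(2) inj assms(4) gap(2,1)] by blast
    moreover have "Re \<nu> < 0"
      using closed_loop_stable[OF assms(4)] \<nu>(1) by (simp add: stable_matrix_def)
    ultimately show ?thesis
      using decay_rate_le[OF \<nu>(1)] by simp
  qed
  have "decay_rate A B \<le> 2 * sqrt 2 * spectral_spread A" if m: "CARD('m) = 1" "CARD('m) < CARD('n)"
  proof (cases "smallest_singular_value B > 2 * sqrt 2 * spectral_spread A")
    case True
    have less: "decay_rate A B < sqrt 3 * spectral_spread A"
      using slow[OF True m(2)] .
    moreover have "0 \<le> decay_rate A B"
      using decay_rate_attained[of A B] by auto
    ultimately have "0 < sqrt 3 * spectral_spread A"
      by linarith
    then have "0 \<le> spectral_spread A"
      by (simp add: zero_less_mult_iff)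
    moreover have "sqrt 3 \<le> 2 * sqrt 2"
      by (rule real_le_lsqrt) (simp_all add: power_mult_distrib)
    ultimately have "sqrt 3 * spectral_spread A \<le> 2 * sqrt 2 * spectral_spread A"
      by (intro mult_right_mono)
    with less show ?thesis
      by linarith
  next
    case False
    then show ?thesis
      using bound matrix_norm_single_input[OF m(1), of B] by linarith
  qed
  with bound slow show ?thesis
    by (intro conjI impI) simp_all
qed

end
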